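(* Each polynomial poly-vector field $A\in\mathfrak{P}^{(k,\ell)}$ admits a unique decomposition $A=A_0+A_1$ with $A_0\in V_{k,\ell}\subset\mathfrak{P}^{(k,\ell)}$ and $A_1\in V_{k-1,\ell-1}\subset\mathfrak{P}^{(k,\ell)}$. Explicitly, the fields are connected by $DA=DA_1$, $DA_0=0$ and $A_1=DA\wedge e^{(k,\ell)}$, i.e. $A=A_0+DA\wedge e^{(k,\ell)}$.
   Context: Let $V$ be an $n$-dimensional real vector space with linear coordinates $x^1,\dots,x^n$ and $\partial_i=\partial/\partial x^i$. $\mathfrak{P}^{(k,\ell)}=S^k(V^* )\otimes\Lambda^\ell V$ denotes the space of $\ell$-vector fields on $V$ whose coefficients are homogeneous polynomials of degree $k$, i.e. $A=\frac{1}{k!\,\ell!}A_{i_1\ldots i_k}{}^{j_1\ldots j_\ell}x^{i_1}\cdots x^{i_k}\partial_{j_1}\wedge\cdots\wedge\partial_{j_\ell}$ with constant coefficients totally symmetric in the lower and totally skew symmetric in the upper indices. The trace operator $D:\mathfrak{P}^{(k,\ell)}\to\mathfrak{P}^{(k-1,\ell-1)}$ is $D=\Psi^{-1}\circ d\circ\Psi$, where $\Psi=dx^1\wedge\cdots\wedge dx^n$ is also used for the isomorphism from $\ell$-vector fields to $(n-\ell)$-forms given by $\Psi(U)(W)=\Psi(U\wedge W)$; in coordinates, for $U=\frac1{\ell!}U^{j_1\ldots j_\ell}\partial_{j_1}\wedge\cdots\wedge\partial_{j_\ell}$, $D(U)=\frac{1}{(\ell-1)!}\partial_mU^{j_1\ldots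 j_{\ell-1}m}\partial_{j_1}\wedge\cdots\wedge\partial_{j_{\ell-1}}$ (and $D=0$ on functions). Set $e^{(k,\ell)}=\frac{1}{n+k-\ell}e_0\in\mathfrak P^{(1,1)}$ with $e_0=x^m\partial_m$ (sum over $m$). As a representation of $\mathfrak{sl}_n(\mathbb{R})$, $\mathfrak{P}^{(k,\ell)}$ decomposes as $V_{k,\ell}\oplus V_{k-1,\ell-1}$, where $V_{k,\ell}$ denotes the representation space of weight $k\lambda_{n-1}+\lambda_\ell$ ($\lambda_m$ the $m$-th fundamental weight). Here the summand $V_{k,\ell}\subset\mathfrak{P}^{(k,\ell)}$ is the kernel of $D$ on $\mathfrak{P}^{(k,\ell)}$, and the summand $V_{k-1,\ell-1}\subset\mathfrak{P}^{(k,\ell)}$ is the invariant complement, which $D$ maps isomorphically onto $V_{k-1,\ell-1}=\ker(D|_{\mathfrak{P}^{(k-1,\ell-1)}})\subset\mathfrak{P}^{(k-1,\ell-1)}$ (spaces with a negative index are zero). *)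

theory Defs
  imports "HOL-Analysis.Analysis" "HOL-Library.Function_Algebras"
begin

instantiation "fun" :: (type, real_vector) real_vector
begin

definition scaleR_fun :: "real \<Rightarrow> ('a \<Rightarrow> 'b) \<Rightarrow> 'a \<Rightarrow> 'b"
  where "scaleR_fun c f = (\<lambda>x. c *\<^sub>R f x)"

instance
  by standard (simp_all add: scaleR_fun_def fun_eq_iff scaleR_add_right scaleR_add_left)

end

text \<open>
  The space \<open>V\<close> is \<^typ>\<open>real^'n\<close>, where the linear order on the finite type \<open>'n\<close> numbers
  the coordinates. The exterior algebra is modelled on the standard basis: the component
  \<open>U $ J\<close> is the coefficient of \<open>\<partial>\<^sub>J = \<partial>\<^sub>j\<^sub>1 \<and> \<dots> \<and> \<partial>\<^sub>j\<^sub>l\<close>, where \<open>J = {j1 < \<dots> < jl}\<close>.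
  The same type is used for exterior forms, \<open>\<omega> $ J\<close> being the coefficient of
  \<open>dx\<^sub>j\<^sub>1 \<and> \<dots> \<and> dx\<^sub>j\<^sub>l\<close>, that is, the value of \<open>\<omega>\<close> on \<open>\<partial>\<^sub>J\<close>.
\<close>

type_synonym 'n ext = "real ^ ('n set)"
type_synonym 'n ext_field = "real ^ 'n \<Rightarrow> real ^ ('n set)"

text \<open>For disjoint \<open>I\<close> and \<open>J\<close>, the sign with \<open>\<partial>\<^sub>I \<and> \<partial>\<^sub>J = shuffle_sign I J \<cdot> \<partial>\<^bsub>I \<union> J\<^esub>\<close>.\<close>

definition shuffle_sign :: "'n::{finite,linorder} set \<Rightarrow> 'n set \<Rightarrow> real"
  where "shuffle_sign I J = (- 1) ^ card {(i, j). i \<in> I \<and> j \<in> J \<and> j < i}"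

definition wedge :: "'n::{finite,linorder} ext \<Rightarrow> 'n ext \<Rightarrow> 'n ext"  (infixl "\<and>\<^sub>e" 70)
  where "U \<and>\<^sub>e W = (\<chi> K. \<Sum>I\<in>Pow K. shuffle_sign I (K - I) * U $ I * W $ (K - I))"

definition wedge_field :: "'n::{finite,linorder} ext_field \<Rightarrow> 'n ext_field \<Rightarrow> 'n ext_field"
    (infixl "\<and>\<^sub>f" 70)
  where "A \<and>\<^sub>f B = (\<lambda>x. A x \<and>\<^sub>e B x)"

definition homogeneous_poly :: "nat \<Rightarrow> (real ^ 'n::finite \<Rightarrow> real) \<Rightarrow> bool"
  where "homogeneous_poly k f \<longleftrightarrow>
    (\<exists>c. f = (\<lambda>x. \<Sum>a | (\<Sum>i\<in>UNIV. a i) = k. c a * (\<Prod>i\<in>UNIV. (x $ i) ^ a i)))"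

definition poly_field :: "nat \<Rightarrow> nat \<Rightarrow> 'n::{finite,linorder} ext_field set"  ("\<PP>")
  where "\<PP> k l = {A. \<forall>J. homogeneous_poly k (\<lambda>x. A x $ J) \<and> (card J \<noteq> l \<longrightarrow> (\<forall>x. A x $ J = 0))}"

definition partial :: "'n::finite \<Rightarrow> (real ^ 'n \<Rightarrow> 'b::real_normed_vector) \<Rightarrow> real ^ 'n \<Rightarrow> 'b"
  where "partial m F x = frechet_derivative F (at x) (axis m 1)"

definition ext_deriv :: "'n::{finite,linorder} ext_field \<Rightarrow> 'n ext_field"
  where "ext_deriv \<omega> x = (\<Sum>m\<in>UNIV. axis {m} 1 \<and>\<^sub>e partial m \<omega> x)"

text \<open>
  \<open>\<Psi>(U)\<close> is the form \<open>W \<mapsto> \<Psi>(U \<and> W)\<close>; the volume form \<open>dx\<^sub>1 \<and> \<dots> \<and> dx\<^sub>n\<close> itself reads off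
  the component at \<^term>\<open>UNIV\<close>.
\<close>

definition Psi :: "'n::{finite,linorder} ext \<Rightarrow> 'n ext"
  where "Psi U = (\<chi> K. (U \<and>\<^sub>e axis K 1) $ UNIV)"

definition trace_op :: "'n::{finite,linorder} ext_field \<Rightarrow> 'n ext_field"
  where "trace_op A = inv Psi \<circ> ext_deriv (Psi \<circ> A)"

lemma shuffle_sign_cases: "shuffle_sign I J = 1 \<or> shuffle_sign I J = - 1"
  unfolding shuffle_sign_def by (rule minus_one_power_iff[THEN ssubst]) simp

lemma shuffle_sign_sq [simp]: "shuffle_sign I J * shuffle_sign I J = 1"
  using shuffle_sign_cases[of I J] by auto

lemma shuffle_sign_Un_left:
  assumes "I \<inter> I' = {}"
  shows "shuffle_sign (I \<union> I') J = shuffle_sign I J * shuffle_sign I' J"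
proof -
  have "{(i, j). i \<in> I \<union> I' \<and> j \<in> J \<and> j < i} =
      {(i, j). i \<in> I \<and> j \<in> J \<and> j < i} \<union> {(i, j). i \<in> I' \<and> j \<in> J \<and> j < i}"
    by auto
  moreover have "{(i, j). i \<in> I \<and> j \<in> J \<and> j < i} \<inter> {(i, j). i \<in> I' \<and> j \<in> J \<and> j < i} = {}"
    using assms by auto
  ultimately show ?thesis
    by (simp add: shuffle_sign_def card_Un_disjoint power_add)
qed

lemma shuffle_sign_Un_right:
  assumes "J \<inter> J' = {}"
  shows "shuffle_sign I (J \<union> J') = shuffle_sign I J * shuffle_sign I J'"
proof -
  have "{(i, j). i \<in> I \<and> j \<in> J \<union> J' \<and> j < i} =
      {(i, j). i \<in> I \<and> j \<in> J \<and> j < i} \<union> {(i, j). i \<in> I \<and> j \<in> J' \<and> j < i}"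
    by auto
  moreover have "{(i, j). i \<in> I \<and> j \<in> J \<and> j < i} \<inter> {(i, j). i \<in> I \<and> j \<in> J' \<and> j < i} = {}"
    using assms by auto
  ultimately show ?thesis
    by (simp add: shuffle_sign_def card_Un_disjoint power_add)
qed

lemma Psi_nth: "Psi U $ K = shuffle_sign (- K) K * U $ (- K)"
proof -
  have "Psi U $ K = (\<Sum>I\<in>UNIV. if I = - K then shuffle_sign (- K) K * U $ (- K) else 0)"
    unfolding Psi_def wedge_def vec_lambda_beta Pow_UNIV
    by (rule sum.cong) (auto simp: axis_def simp flip: Compl_eq_Diff_UNIV)
  then show ?thesis by simp
qed

lemma wedge_axis_nth:
  "(axis {m} 1 \<and>\<^sub>e W) $ K = (if m \<in> K then shuffle_sign {m} (K - {m}) * W $ (K - {m}) else 0)"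
proof -
  have "(axis {m} 1 \<and>\<^sub>e W) $ K =
      (\<Sum>I\<in>Pow K. if I = {m} then shuffle_sign {m} (K - {m}) * W $ (K - {m}) else 0)"
    unfolding wedge_def vec_lambda_beta by (rule sum.cong) (auto simp: axis_def)
  then show ?thesis by simp
qed

lemma bij_Psi: "bij (Psi :: 'n::{finite,linorder} ext \<Rightarrow> 'n ext)"
proof (rule bijI)
  show "inj (Psi :: 'n ext \<Rightarrow> 'n ext)"
  proof (rule injI)
    fix U U' :: "'n ext" assume *: "Psi U = Psi U'"
    show "U = U'"
      unfolding vec_eq_iff
    proof
      fix J :: "'n set"
      have "shuffle_sign J (- J) * U $ J = shuffle_sign J (- J) * U' $ J"
        using arg_cong[OF *, of "\<lambda>W. W $ (- J)"] unfolding Psi_nth double_complement .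
      then show "U $ J = U' $ J"
        using shuffle_sign_cases[of J "- J"] by (elim disjE) simp_all
    qed
  qed
  show "surj (Psi :: 'n ext \<Rightarrow> 'n ext)"
  proof (rule surjI)
    fix W :: "'n ext"
    show "Psi (\<chi> J. shuffle_sign J (- J) * W $ (- J)) = W"
      by (simp add: vec_eq_iff Psi_nth flip: mult.assoc)
  qed
qed

lemma linear_Psi: "linear Psi"
  by (rule linearI) (simp_all add: vec_eq_iff Psi_nth algebra_simps)

text \<open>The coordinate form of the trace operator: the index \<open>m\<close> of the derivative comes last.\<close>

lemma trace_op_nth:
  fixes A :: "'n::{finite,linorder} ext_field"
  assumes "A differentiable (at x)"
  shows "trace_op A x $ J = (\<Sum>m\<in>- J. shuffle_sign J {m} * partial m A x $ insert m J)"
proof -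
  have d: "(Psi \<circ> A has_derivative Psi \<circ> frechet_derivative A (at x)) (at x)"
    using diff_chain_at[OF frechet_derivative_works[THEN iffD1, OF assms]
        linear_imp_has_derivative[OF linear_Psi]] .
  have p: "partial m (Psi \<circ> A) x = Psi (partial m A x)" for m
    unfolding partial_def frechet_derivative_at[OF d, symmetric] by simp
  have "Psi (\<chi> J. \<Sum>m\<in>- J. shuffle_sign J {m} * partial m A x $ insert m J) =
      ext_deriv (Psi \<circ> A) x"
  proof (rule vec_eq_iff[THEN iffD2], rule allI)
    fix K :: "'n set"
    have s: "shuffle_sign (- K) K * (shuffle_sign (- K) {m} * y) =
        shuffle_sign {m} (K - {m}) * (shuffle_sign (- (K - {m})) (K - {m}) * y)"
      if m: "m \<in> K" for m y
    proof -
      have K: "K = {m} \<union> (K - {m})" and nK: "- (K - {m}) = - K \<union> {m}" using m by auto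
      have 1: "shuffle_sign (- K) K = shuffle_sign (- K) {m} * shuffle_sign (- K) (K - {m})"
        using shuffle_sign_Un_right[of "{m}" "K - {m}" "- K"] K by simp
      have 2: "shuffle_sign (- (K - {m})) (K - {m}) =
          shuffle_sign (- K) (K - {m}) * shuffle_sign {m} (K - {m})"
        unfolding nK using m by (subst shuffle_sign_Un_left) auto
      show ?thesis
        unfolding 1 2 using shuffle_sign_cases[of "- K" "{m}"] shuffle_sign_cases[of "{m}" "K - {m}"]
        by (elim disjE) simp_all
    qed
    have c: "insert m (- K) = - (K - {m})" if "m \<in> K" for m using that by auto
    show "Psi (\<chi> J. \<Sum>m\<in>- J. shuffle_sign J {m} * partial m A x $ insert m J) $ K =
        ext_deriv (Psi \<circ> A) x $ K"
      unfolding ext_deriv_def sum_component wedge_axis_nth p Psi_nth vec_lambda_beta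
        sum_distrib_left sum.If_cases[OF finite]
        double_complement Int_UNIV_left Collect_mem_eq sum.neutral_const add_0_right
      by (rule sum.cong) (simp_all only: s c)
  qed
  then have "trace_op A x = (\<chi> J. \<Sum>m\<in>- J. shuffle_sign J {m} * partial m A x $ insert m J)"
    unfolding trace_op_def o_apply[of "inv Psi"]
    by (rule subst) (rule inv_f_f[OF bij_is_inj[OF bij_Psi]])
  then show ?thesis by simp
qed

definition e0_field :: "'n::{finite,linorder} ext_field"
  where "e0_field x = (\<Sum>m\<in>UNIV. x $ m *\<^sub>R axis {m} 1)"

text \<open>If \<open>k = 0\<close> and \<open>l = n\<close> the factor is \<open>1 / 0 = 0\<close>; there the trace operator vanishes anyway.\<close>

definition e_field :: "nat \<Rightarrow> nat \<Rightarrow> 'n::{finite,linorder} ext_field"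
  where "e_field k l = (1 / (real CARD('n) + real k - real l)) *\<^sub>R e0_field"

text \<open>Contraction with \<open>dx\<^sub>j\<close>: \<open>\<partial>\<^sub>j \<and> \<partial>\<^sub>J \<mapsto> \<partial>\<^sub>J\<close> and \<open>\<partial>\<^sub>J \<mapsto> 0\<close> for \<open>j \<notin> J\<close>.\<close>

definition contract :: "'n::{finite,linorder} \<Rightarrow> 'n ext \<Rightarrow> 'n ext"
  where "contract j U = (\<chi> J. if j \<in> J then 0 else shuffle_sign {j} J * U $ insert j J)"

text \<open>
  The representation of matrices on polynomial maps from \<open>V\<close> to its exterior algebra: \<open>M\<close> acts on
  the values by the derivation extending \<open>v \<mapsto> M v\<close>, and on the coefficients by the dual
  representation. It is the derivative at \<open>t = 0\<close> of the push-forward along \<open>exp (t M)\<close>.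
\<close>

definition ext_derivation :: "real ^ 'n::{finite,linorder} ^ 'n::{finite,linorder} \<Rightarrow> 'n ext \<Rightarrow> 'n ext"
  where "ext_derivation M U = (\<Sum>i\<in>UNIV. \<Sum>j\<in>UNIV. M $ i $ j *\<^sub>R (axis {i} 1 \<and>\<^sub>e contract j U))"

definition mat_act :: "real ^ 'n::{finite,linorder} ^ 'n::{finite,linorder} \<Rightarrow> 'n ext_field \<Rightarrow> 'n ext_field"
  where "mat_act M A = (\<lambda>x. ext_derivation M (A x) - frechet_derivative A (at x) (M *v x))"

definition sl_invariant :: "'n::{finite,linorder} ext_field set \<Rightarrow> bool"
  where "sl_invariant W \<longleftrightarrow> (\<forall>M. \<forall>A\<in>W. trace M = 0 \<longrightarrow> mat_act M A \<in> W)"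

text \<open>The summand \<open>V\<^bsub>k,l\<^esub>\<close> of \<^term>\<open>\<PP> k l\<close>.\<close>

definition trace_free :: "nat \<Rightarrow> nat \<Rightarrow> 'n::{finite,linorder} ext_field set"
  where "trace_free k l = {A \<in> \<PP> k l. trace_op A = 0}"

definition invariant_complement ::
    "nat \<Rightarrow> nat \<Rightarrow> 'n::{finite,linorder} ext_field set \<Rightarrow> bool"
  where "invariant_complement k l W \<longleftrightarrow>
    subspace W \<and> W \<subseteq> \<PP> k l \<and> sl_invariant W \<and>
    trace_free k l \<inter> W = {0} \<and> (\<forall>A\<in>\<PP> k l. \<exists>A0\<in>trace_free k l. \<exists>A1\<in>W. A = A0 + A1)"

text \<open>The summand \<open>V\<^bsub>k-1,l-1\<^esub>\<close> of \<^term>\<open>\<PP> k l\<close>.\<close>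

definition trace_summand :: "nat \<Rightarrow> nat \<Rightarrow> 'n::{finite,linorder} ext_field set"
  where "trace_summand k l = (THE W. invariant_complement k l W)"

end

theory Submission
  imports Defs
begin

text \<open>
  Let \<open>\<epsilon>\<^sub>i\<close> be exterior multiplication by \<open>\<partial>\<^sub>i\<close> and \<open>\<iota>\<^sub>j\<close> contraction with \<open>dx\<^sub>j\<close>. Put
  \<open>\<delta> = \<Sum> \<iota>\<^sub>j \<partial>\<^sub>j\<close> and \<open>e = \<Sum> x\<^sub>i \<epsilon>\<^sub>i\<close>. The signs are such that \<open>DA \<and> e\<^sub>0 = e \<delta> A\<close>, and \<open>DA = 0\<close> if and
  only if \<open>\<delta> A = 0\<close> (\<open>trace_op_eq_divergence\<close>, \<open>trace_op_wedge_e_field\<close>). The statement is thus about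
  the operator \<open>e \<delta>\<close> on fields of bidegree \<open>(k, l)\<close>, and the canonical commutation and
  anticommutation relations carry the proof.

  First, \<open>\<delta> e + e \<delta> = n - N + E\<close> with the number operator \<open>N\<close> and the Euler operator \<open>E\<close>, and
  \<open>\<delta>\<^sup>2 = 0\<close>. Hence \<open>\<delta> e \<delta> = (n + k - l) \<delta>\<close> on \<open>\<PP> k l\<close> (\<open>divergence_e0_wedge_divergence\<close>), so
  \<open>A \<mapsto> DA \<and> e\<^bsup>(k,l)\<^esup>\<close> is a projection with kernel \<open>ker D\<close>. Since \<open>e\<close> and \<open>\<delta>\<close> commute with the action of
  matrices, its range is an invariant complement of \<open>ker D\<close> (\<open>invariant_complement_trace_image\<close>).

  The summand \<open>V\<^bsub>k-1,l-1\<^esub>\<close> is characterised as the only invariant complement, so uniqueness has to be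
  proved too. Instead of the irreducibility of the two summands the Casimir operator is used. On
  \<open>\<PP> k l\<close> it equals a constant minus \<open>2 e \<delta>\<close> (\<open>Casimir\<close>), so any invariant subspace is stable under the
  projection (\<open>trace_part_mem_invariant\<close>), and an invariant complement of its kernel must be its range
  (\<open>trace_summand_eq\<close>). Given this, \<open>A\<^sub>1\<close> is the image of \<open>A\<close> under the projection.
\<close>

section \<open>Partial derivatives of polynomial maps\<close>

lemma partial_eqI: "(F has_derivative F') (at x) \<Longrightarrow> partial m F x = F' (axis m 1)"
  unfolding partial_def by (metis frechet_derivative_at)

lemma has_derivative_poly:
  fixes F :: "real ^ 'n::finite \<Rightarrow> 'b::euclidean_space"
  assumes "polynomial_function F"
  shows "(F has_derivative frechet_derivative F (at x)) (at x)"
  using differentiable_at_polynomial_function[OF assms] frechet_derivative_works by blast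

lemma partial_add:
  fixes F G :: "real ^ 'n::finite \<Rightarrow> 'b::euclidean_space"
  assumes "polynomial_function F" "polynomial_function G"
  shows "partial m (\<lambda>x. F x + G x) x = partial m F x + partial m G x"
  using partial_eqI[OF has_derivative_add[OF has_derivative_poly[OF assms(1)] has_derivative_poly[OF assms(2)]]]
  by (simp add: partial_def)

lemma partial_const [simp]: "partial m (\<lambda>_. c) x = 0"
  using partial_eqI[OF has_derivative_const] .

lemma partial_diff:
  fixes F G :: "real ^ 'n::finite \<Rightarrow> 'b::euclidean_space"
  assumes "polynomial_function F" "polynomial_function G"
  shows "partial m (\<lambda>x. F x - G x) x = partial m F x - partial m G x"
  using partial_eqI[OF has_derivative_diff[OF has_derivative_poly[OF assms(1)] has_derivative_poly[OF assms(2)]]]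
  by (simp add: partial_def)

lemma partial_sum:
  fixes F :: "'i \<Rightarrow> real ^ 'n::finite \<Rightarrow> 'b::euclidean_space"
  assumes "\<And>i. i \<in> S \<Longrightarrow> polynomial_function (F i)"
  shows "partial m (\<lambda>x. \<Sum>i\<in>S. F i x) x = (\<Sum>i\<in>S. partial m (F i) x)"
  using partial_eqI[OF has_derivative_sum[OF has_derivative_poly[OF assms]]]
  by (simp add: partial_def)

lemma partial_linear:
  fixes F :: "real ^ 'n::finite \<Rightarrow> 'b::euclidean_space" and h :: "'b \<Rightarrow> 'c::real_normed_vector"
  assumes "polynomial_function F" "linear h"
  shows "partial m (\<lambda>x. h (F x)) x = h (partial m F x)"
proof -
  have "((\<lambda>x. h (F x)) has_derivative (\<lambda>v. h (frechet_derivative F (at x) v))) (at x)"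
    using bounded_linear.has_derivative[OF linear_conv_bounded_linear[THEN iffD1, OF assms(2)]
        has_derivative_poly[OF assms(1)]] .
  from partial_eqI[OF this] show ?thesis by (simp add: partial_def)
qed

lemma partial_scaleR:
  fixes f :: "real ^ 'n::finite \<Rightarrow> real" and F :: "real ^ 'n::finite \<Rightarrow> 'b::euclidean_space"
  assumes "polynomial_function f" "polynomial_function F"
  shows "partial m (\<lambda>x. f x *\<^sub>R F x) x = partial m f x *\<^sub>R F x + f x *\<^sub>R partial m F x"
  using partial_eqI[OF has_derivative_scaleR[OF has_derivative_poly[OF assms(1)] has_derivative_poly[OF assms(2)]]]
  by (simp add: partial_def add.commute)

lemma linear_coord: "linear (\<lambda>x::real^'n::finite. x $ i)"
  by (simp add: linear_iff)

lemma polynomial_coord: "polynomial_function (\<lambda>x::real^'n::finite. x $ i)"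
  by (simp add: bounded_linear_vec_nth polynomial_function_bounded_linear)

lemma partial_bounded_linear: "bounded_linear f \<Longrightarrow> partial m f x = f (axis m 1)"
  by (intro partial_eqI bounded_linear_imp_has_derivative)

lemma partial_coord: "partial m (\<lambda>x. x $ i) x = (if i = m then 1 else 0)"
  by (auto simp: partial_bounded_linear[OF bounded_linear_vec_nth] axis_def)

lemma partial_coord_scaleR:
  fixes F :: "real ^ 'n::finite \<Rightarrow> 'b::euclidean_space"
  assumes "polynomial_function F"
  shows "partial m (\<lambda>x. x $ i *\<^sub>R F x) x = (if i = m then F x else 0) + x $ i *\<^sub>R partial m F x"
  by (simp add: partial_scaleR[OF polynomial_coord assms] partial_coord)

lemma real_polynomial_partial:
  fixes f :: "real ^ 'n::finite \<Rightarrow> real"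
  assumes "real_polynomial_function f"
  shows "real_polynomial_function (partial m f)"
  using assms
proof induction
  case (linear f)
  then have "partial m f = (\<lambda>x. f (axis m 1))" by (auto simp: partial_bounded_linear)
  then show ?case by (simp add: real_polynomial_function.intros(2))
next
  case (const c)
  have "partial m (\<lambda>x::real^'n. c) = (\<lambda>x. 0)" by auto
  then show ?case by (simp add: real_polynomial_function.intros(2))
next
  case (add f g)
  then have "partial m (\<lambda>x. f x + g x) = (\<lambda>x. partial m f x + partial m g x)"
    by (auto simp: partial_add real_polynomial_function_eq)
  then show ?case using add by (simp add: real_polynomial_function.intros(3))
next
  case (mult f g)
  then have "partial m (\<lambda>x. f x * g x) = (\<lambda>x. partial m f x * g x + f x * partial m g x)"
    using partial_scaleR[of f g] by (auto simp: real_polynomial_function_eq)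
  then show ?case using mult by (auto intro!: real_polynomial_function.intros(3,4))
qed

text \<open>
  Both sides are derivations in each index, so it suffices to check linear maps and constants.
\<close>

lemma real_polynomial_partial_commute:
  fixes f :: "real ^ 'n::finite \<Rightarrow> real"
  assumes "real_polynomial_function f"
  shows "partial i (partial j f) x = partial j (partial i f) x"
  using assms
proof (induction arbitrary: x)
  case (linear f)
  then have "partial m f = (\<lambda>x. f (axis m 1))" for m by (auto simp: partial_bounded_linear)
  then show ?case by simp
next
  case (const c)
  have "partial m (\<lambda>x::real^'n. c) = (\<lambda>x. 0)" for m by auto
  then show ?case by simp
next
  case (add f g)
  then have "partial m (\<lambda>x. f x + g x) = (\<lambda>x. partial m f x + partial m g x)" for m
    by (auto simp: partial_add real_polynomial_function_eq)
  then show ?case using add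
    by (simp add: partial_add real_polynomial_partial flip: real_polynomial_function_eq)
next
  case (mult f g)
  have *: "partial m (\<lambda>x. f x * g x) = (\<lambda>x. partial m f x * g x + f x * partial m g x)"
    if "real_polynomial_function f" "real_polynomial_function g" for f g :: "real ^ 'n::finite \<Rightarrow> real" and m
    using partial_scaleR[of f g] that by (auto simp: real_polynomial_function_eq)
  show ?case using mult
    by (simp add: * partial_add real_polynomial_partial real_polynomial_function.intros(4)
         flip: real_polynomial_function_eq)
qed

lemma polynomial_function_vec_iff:
  fixes F :: "real ^ 'n::finite \<Rightarrow> real ^ 'm::finite"
  shows "polynomial_function F \<longleftrightarrow> (\<forall>J. real_polynomial_function (\<lambda>x. F x $ J))"
  by (auto simp: polynomial_function_iff_Basis_inner Basis_vec_def inner_axis)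

lemma partial_nth:
  fixes F :: "real ^ 'n::finite \<Rightarrow> real ^ 'm::finite"
  assumes "polynomial_function F"
  shows "partial m F x $ J = partial m (\<lambda>x. F x $ J) x"
  by (rule partial_linear[symmetric, OF assms linear_coord])

lemma polynomial_partial:
  fixes F :: "real ^ 'n::finite \<Rightarrow> real ^ 'm::finite"
  assumes "polynomial_function F"
  shows "polynomial_function (partial m F)"
  using assms by (simp add: polynomial_function_vec_iff partial_nth real_polynomial_partial)

lemma partial_commute:
  fixes F :: "real ^ 'n::finite \<Rightarrow> real ^ 'm::finite"
  assumes "polynomial_function F"
  shows "partial i (partial j F) x = partial j (partial i F) x"
proof (subst vec_eq_iff, rule allI)
  fix J
  have "(\<lambda>x. partial m F x $ J) = partial m (\<lambda>x. F x $ J)" for m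
    using assms by (simp add: partial_nth)
  then show "partial i (partial j F) x $ J = partial j (partial i F) x $ J"
    using real_polynomial_partial_commute[of "\<lambda>x. F x $ J" i j x] assms
    by (simp add: partial_nth polynomial_partial) (simp add: polynomial_function_vec_iff)
qed

lemma polynomial_linear_comp:
  fixes F :: "real ^ 'n::finite \<Rightarrow> 'b::euclidean_space" and h :: "'b \<Rightarrow> 'c::euclidean_space"
  assumes "polynomial_function F" "linear h"
  shows "polynomial_function (\<lambda>x. h (F x))"
  using polynomial_function_compose[OF assms(1), of h] assms(2)
  by (simp add: o_def polynomial_function_bounded_linear linear_conv_bounded_linear)

lemma directional_derivative:
  fixes F :: "real ^ 'n::finite \<Rightarrow> 'b::euclidean_space"
  assumes "polynomial_function F"
  shows "frechet_derivative F (at x) v = (\<Sum>i\<in>UNIV. v $ i *\<^sub>R partial i F x)"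
proof -
  interpret linear "frechet_derivative F (at x)"
    using has_derivative_linear[OF has_derivative_poly[OF assms]] .
  have "frechet_derivative F (at x) v = frechet_derivative F (at x) (\<Sum>i\<in>UNIV. v $ i *s axis i 1)"
    by (simp only: basis_expansion)
  then show ?thesis
    by (simp add: sum scale partial_def scalar_mult_eq_scaleR)
qed

section \<open>Homogeneous polynomials\<close>

text \<open>
  The homogeneous polynomials generated from constants by multiplication with coordinates: the
  induction rule replaces computations with multi-indices.
\<close>

inductive homogeneous :: "nat \<Rightarrow> (real ^ 'n::finite \<Rightarrow> real) \<Rightarrow> bool" where
  const: "homogeneous 0 (\<lambda>_. c)"
| zero: "homogeneous k (\<lambda>_. 0)"
| coord: "homogeneous k f \<Longrightarrow> homogeneous (Suc k) (\<lambda>x. x $ i * f x)"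
| add: "homogeneous k f \<Longrightarrow> homogeneous k g \<Longrightarrow> homogeneous k (\<lambda>x. f x + g x)"

lemma homogeneous_scale: "homogeneous k f \<Longrightarrow> homogeneous k (\<lambda>x. c * f x)"
proof (induction rule: homogeneous.induct)
  case (coord k f i)
  then show ?case using homogeneous.coord[of k "\<lambda>x. c * f x" i] by (simp add: mult_ac)
qed (auto simp: distrib_left intro: homogeneous.intros)

lemma homogeneous_sum:
  "(\<And>i. i \<in> S \<Longrightarrow> homogeneous k (f i)) \<Longrightarrow> homogeneous k (\<lambda>x. \<Sum>i\<in>S. f i x)"
  by (induction S rule: infinite_finite_induct) (auto intro: homogeneous.zero homogeneous.add)

lemma homogeneous_monomial:
  "homogeneous (\<Sum>i\<in>UNIV. a i) (\<lambda>x::real^'n::finite. \<Prod>i\<in>UNIV. (x $ i) ^ a i)"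
proof (induction "\<Sum>i\<in>UNIV. a i" arbitrary: a)
  case 0
  then have "a = (\<lambda>_. 0)" by (auto simp: fun_eq_iff)
  then show ?case by (simp add: homogeneous.const)
next
  case (Suc k)
  then obtain j where j: "a j > 0" by (metis not_gr0 sum.neutral nat.distinct(1))
  define b where "b = a(j := a j - 1)"
  have a: "a = b(j := Suc (b j))" using j by (auto simp: b_def)
  have "k = (\<Sum>i\<in>UNIV. b i)"
    using Suc(2) unfolding a by (simp add: sum.remove[of UNIV j])
  moreover have "(\<Prod>i\<in>UNIV. (x $ i) ^ a i) = x $ j * (\<Prod>i\<in>UNIV. (x $ i) ^ b i)" for x :: "real^'n"
    unfolding a by (simp add: prod.remove[of UNIV j])
  ultimately show ?case
    using homogeneous.coord[OF Suc(1)[of b], of j] Suc(2) by simp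
qed

lemma finite_multi_indices: "finite {a :: 'n::finite \<Rightarrow> nat. (\<Sum>i\<in>UNIV. a i) = k}"
proof (rule finite_subset)
  show "{a :: 'n \<Rightarrow> nat. (\<Sum>i\<in>UNIV. a i) = k} \<subseteq> UNIV \<rightarrow>\<^sub>E {..k}"
    by (auto simp: PiE_def intro: member_le_sum)
qed (auto intro: finite_PiE)

text \<open>
  Multiplication by \<open>x\<^sub>j\<close> shifts the multi-index \<open>a\<close> to \<open>a + e\<^sub>j\<close>. The shift is a bijection onto the
  indices of degree \<open>k + 1\<close> with \<open>a\<^sub>j > 0\<close>, and the remaining coefficients are set to \<open>0\<close>.
\<close>

lemma homogeneous_poly_coord:
  assumes "homogeneous_poly k f"
  shows "homogeneous_poly (Suc k) (\<lambda>x. x $ j * f x)"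
proof -
  from assms obtain c
    where f: "f = (\<lambda>x. \<Sum>a | (\<Sum>i\<in>UNIV. a i) = k. c a * (\<Prod>i\<in>UNIV. (x $ i) ^ a i))"
    by (auto simp: homogeneous_poly_def)
  define c' where "c' a = (if a j = 0 then 0 else c (a(j := a j - 1)))" for a
  let ?r = "\<lambda>a. a(j := Suc (a j))"
  have "x $ j * f x = (\<Sum>a | (\<Sum>i\<in>UNIV. a i) = Suc k. c' a * (\<Prod>i\<in>UNIV. (x $ i) ^ a i))" for x
    unfolding f sum_distrib_left
  proof (rule sum.reindex_bij_witness_not_neutral[where i = "\<lambda>a. a(j := a j - 1)" and j = ?r
      and S' = "{}" and T' = "{a. (\<Sum>i\<in>UNIV. a i) = Suc k \<and> a j = 0}"])
    show "finite {a::'a\<Rightarrow>nat. sum a UNIV = Suc k \<and> a j = 0}"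
      by (rule finite_subset[OF _ finite_multi_indices[of "Suc k"]]) auto
  next
    fix a :: "'a \<Rightarrow> nat" assume a: "a \<in> {a. sum a UNIV = k} - {}"
    show "?r a \<in> {a. sum a UNIV = Suc k} - {a. sum a UNIV = Suc k \<and> a j = 0}"
      using a by (auto simp: sum.remove[of UNIV j])
  next
    fix a :: "'a \<Rightarrow> nat"
    have "(\<Prod>i\<in>UNIV. (x $ i) ^ ?r a i) = x $ j * (\<Prod>i\<in>UNIV. (x $ i) ^ a i)"
      by (simp add: prod.remove[of UNIV j])
    then show "c' (?r a) * (\<Prod>i\<in>UNIV. (x $ i) ^ ?r a i) = x $ j * (c a * (\<Prod>i\<in>UNIV. (x $ i) ^ a i))"
      by (simp add: c'_def)
  next
    fix a :: "'a \<Rightarrow> nat"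
    assume a: "a \<in> {a. sum a UNIV = Suc k} - {a. sum a UNIV = Suc k \<and> a j = 0}"
    then show "?r (a(j := a j - 1)) = a" by auto
    show "a(j := a j - 1) \<in> {a. sum a UNIV = k} - {}"
      using a by (auto simp: sum.remove[of UNIV j])
  qed (auto simp: c'_def)
  then show ?thesis unfolding homogeneous_poly_def by blast
qed

lemma homogeneous_poly_iff: "homogeneous_poly k f \<longleftrightarrow> homogeneous k f"
proof
  assume "homogeneous_poly k f"
  then obtain c
    where f: "f = (\<lambda>x. \<Sum>a | (\<Sum>i\<in>UNIV. a i) = k. c a * (\<Prod>i\<in>UNIV. (x $ i) ^ a i))"
    by (auto simp: homogeneous_poly_def)
  show "homogeneous k f"
    unfolding f by (intro homogeneous_sum homogeneous_scale) (use homogeneous_monomial in auto)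
next
  assume "homogeneous k f"
  then show "homogeneous_poly k f"
  proof induction
    case (const c)
    have "{a. (\<Sum>i\<in>UNIV. a i) = 0} = {\<lambda>_::'a. 0::nat}" by (auto simp: fun_eq_iff)
    then show ?case unfolding homogeneous_poly_def by (intro exI[of _ "\<lambda>_. c"]) simp
  next
    case (zero k)
    show ?case unfolding homogeneous_poly_def by (intro exI[of _ "\<lambda>_. 0"]) simp
  next
    case (coord k f i)
    then show ?case by (simp add: homogeneous_poly_coord)
  next
    case (add k f g)
    then obtain c d where "f = (\<lambda>x. \<Sum>a | (\<Sum>i\<in>UNIV. a i) = k. c a * (\<Prod>i\<in>UNIV. (x $ i) ^ a i))"
      "g = (\<lambda>x. \<Sum>a | (\<Sum>i\<in>UNIV. a i) = k. d a * (\<Prod>i\<in>UNIV. (x $ i) ^ a i))"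
      by (auto simp: homogeneous_poly_def)
    then show ?case unfolding homogeneous_poly_def
      by (intro exI[of _ "\<lambda>a. c a + d a"]) (simp add: sum.distrib distrib_right)
  qed
qed

lemma homogeneous_polynomial: "homogeneous k f \<Longrightarrow> real_polynomial_function f"
  by (induction rule: homogeneous.induct)
     (auto intro!: real_polynomial_function.intros(2-)
        intro: real_polynomial_function.intros(1) bounded_linear_vec_nth)

text \<open>
  Every operator used below is assembled from \<open>x\<^sub>i \<partial>\<^sub>j\<close> and constant endomorphisms of the exterior
  algebra. Treating \<open>x\<^sub>i \<partial>\<^sub>j\<close> as one operator keeps the degree fixed, so that the case \<open>k = 0\<close>
  does not have to be singled out.
\<close>

lemma homogeneous_partial:
  assumes "homogeneous k f"
  shows "homogeneous k (\<lambda>x. x $ i * partial j f x)"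
  using assms
proof induction
  case (coord k f m)
  have "partial j (\<lambda>x. x $ m * f x) = (\<lambda>x. (if m = j then f x else 0) + x $ m * partial j f x)"
    using partial_coord_scaleR[of f] homogeneous_polynomial[OF coord(1)]
    by (auto simp: real_polynomial_function_eq)
  then have "(\<lambda>x. x $ i * partial j (\<lambda>x. x $ m * f x) x) =
     (\<lambda>x. x $ i * (if m = j then f x else 0) + x $ m * (x $ i * partial j f x))"
    by (auto simp: algebra_simps)
  then show ?case using coord by (cases "m = j") (auto intro: homogeneous.intros)
next
  case (add k f g)
  then have "partial j (\<lambda>x. f x + g x) = (\<lambda>x. partial j f x + partial j g x)"
    by (auto simp: partial_add homogeneous_polynomial simp flip: real_polynomial_function_eq)
  then show ?case using add by (auto simp: distrib_left intro: homogeneous.intros)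
qed (auto intro: homogeneous.zero)

lemma homogeneous_Euler:
  assumes "homogeneous k f"
  shows "(\<Sum>i\<in>UNIV. x $ i * partial i f x) = real k * f x"
  using assms
proof induction
  case (coord k f m)
  have "partial j (\<lambda>x. x $ m * f x) x = (if m = j then f x else 0) + x $ m * partial j f x" for j
    using partial_coord_scaleR[of f] homogeneous_polynomial[OF coord(1)]
    by (auto simp: real_polynomial_function_eq)
  then have "(\<Sum>i\<in>UNIV. x $ i * partial i (\<lambda>x. x $ m * f x) x) =
     (\<Sum>i\<in>UNIV. (if m = i then x $ m * f x else 0)) + x $ m * (\<Sum>i\<in>UNIV. x $ i * partial i f x)"
    unfolding sum_distrib_left sum.distrib[symmetric] by (intro sum.cong) (auto simp: algebra_simps)
  then show ?case using coord by (simp add: algebra_simps)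
next
  case (add k f g)
  then have "partial j (\<lambda>x. f x + g x) = (\<lambda>x. partial j f x + partial j g x)" for j
    by (auto simp: partial_add homogeneous_polynomial simp flip: real_polynomial_function_eq)
  then show ?case using add by (auto simp: distrib_left sum.distrib)
qed auto

section \<open>Creation and annihilation operators\<close>

text \<open>
  \<open>\<epsilon> i\<close> is exterior multiplication by \<open>\<partial>\<^sub>i\<close> from the left and \<open>\<iota> j\<close> is contraction with \<open>dx\<^sub>j\<close>.
  They satisfy the canonical anticommutation relations (\<open>iota_eps\<close>, \<open>iota_iota\<close>, \<open>eps_eps\<close>); once
  these are available no sign of the exterior product has to be computed any more.
\<close>

abbreviation eps :: "'n::{finite,linorder} \<Rightarrow> 'n ext \<Rightarrow> 'n ext"  ("\<epsilon>")
  where "\<epsilon> i U \<equiv> axis {i} 1 \<and>\<^sub>e U"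

abbreviation iota :: "'n::{finite,linorder} \<Rightarrow> 'n ext \<Rightarrow> 'n ext"  ("\<iota>")
  where "\<iota> j U \<equiv> contract j U"

lemma contract_nth: "\<iota> j U $ J = (if j \<in> J then 0 else shuffle_sign {j} J * U $ insert j J)"
  by (simp add: contract_def)

lemma linear_eps: "linear (\<epsilon> i)"
  by (rule linearI) (simp_all add: vec_eq_iff wedge_axis_nth distrib_left)

lemma linear_iota: "linear (\<iota> j)"
  by (rule linearI) (simp_all add: vec_eq_iff contract_nth distrib_left)

lemmas ext_linear = linear_add[OF linear_eps] linear_diff[OF linear_eps] linear_scale[OF linear_eps]
  linear_sum[OF linear_eps] linear_0[OF linear_eps]
  linear_add[OF linear_iota] linear_diff[OF linear_iota] linear_scale[OF linear_iota]
  linear_sum[OF linear_iota] linear_0[OF linear_iota]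

definition swap_sign :: "'n::linorder \<Rightarrow> 'n \<Rightarrow> real"
  where "swap_sign a b = (if b < a then - 1 else 1)"

lemma shuffle_sign_insert:
  assumes "b \<notin> J"
  shows "shuffle_sign {a} (insert b J) = swap_sign a b * shuffle_sign {a} J"
proof -
  have "{(i, j). i \<in> {a} \<and> j \<in> {b} \<and> j < i} = (if b < a then {(a, b)} else {})" by auto
  then have "shuffle_sign {a} {b} = swap_sign a b"
    by (simp add: shuffle_sign_def swap_sign_def)
  then show ?thesis
    using shuffle_sign_Un_right[of "{b}" J "{a}"] assms by simp
qed

lemma swap_sign_antisym: "a \<noteq> b \<Longrightarrow> swap_sign a b = - swap_sign b a"
  by (auto simp: swap_sign_def)

lemma shuffle_sign_singleton_right:
  assumes "m \<notin> J"
  shows "shuffle_sign J {m} = (- 1) ^ card J * shuffle_sign {m} J"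
proof -
  have 1: "{(i, j). i \<in> J \<and> j \<in> {m} \<and> j < i} = (\<lambda>i. (i, m)) ` {i \<in> J. m < i}" by auto
  have 2: "{(i, j). i \<in> {m} \<and> j \<in> J \<and> j < i} = Pair m ` {i \<in> J. i < m}" by auto
  have "{i \<in> J. m < i} \<union> {i \<in> J. i < m} = J" using assms by (auto, metis linorder_neqE)
  moreover have "{i \<in> J. m < i} \<inter> {i \<in> J. i < m} = {}" by auto
  ultimately have "card J = card {i \<in> J. m < i} + card {i \<in> J. i < m}"
    using card_Un_disjoint[of "{i \<in> J. m < i}" "{i \<in> J. i < m}"] by simp
  then show ?thesis
    unfolding shuffle_sign_def 1 2 
    by (simp add: card_image inj_on_def power_add mult.assoc flip: power_mult_distrib)
qed

text \<open>
  The contraction is an antiderivation. For \<open>i \<noteq> j\<close> both terms have the same component of \<open>U\<close>, and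
  moving \<open>i\<close> past \<open>j\<close> in one of them accounts for the opposite sign.
\<close>

lemma iota_eps: "\<iota> j (\<epsilon> i U) = (if i = j then U else 0) - \<epsilon> i (\<iota> j U)"
proof (subst vec_eq_iff, rule allI)
  fix K
  show "\<iota> j (\<epsilon> i U) $ K = ((if i = j then U else 0) - \<epsilon> i (\<iota> j U)) $ K"
  proof (cases "i = j")
    case True
    then show ?thesis
      by (cases "j \<in> K") (simp_all add: contract_nth wedge_axis_nth insert_absorb flip: mult.assoc)
  next
    case False
    show ?thesis
    proof (cases "i \<in> K \<and> j \<notin> K")
      case True
      then obtain M where M: "K = insert i M" "i \<notin> M" by (meson mk_disjoint_insert)
      have "insert j (insert i M) - {i} = insert j M" using False M by auto
      then have "\<iota> j (\<epsilon> i U) $ K = swap_sign j i * swap_sign i j *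
            (shuffle_sign {j} M * shuffle_sign {i} M * U $ insert j M)"
        "\<epsilon> i (\<iota> j U) $ K = shuffle_sign {j} M * shuffle_sign {i} M * U $ insert j M"
        using True M False by (simp_all add: contract_nth wedge_axis_nth shuffle_sign_insert)
      moreover have "swap_sign j i * swap_sign i j = - 1"
        using False by (auto simp: swap_sign_def)
      ultimately show ?thesis using False by simp
    qed (use False in \<open>auto simp: contract_nth wedge_axis_nth\<close>)
  qed
qed

lemma iota_iota: "\<iota> i (\<iota> j U) = - \<iota> j (\<iota> i U)"
  by (cases "i = j")
     (auto simp: vec_eq_iff contract_nth shuffle_sign_insert swap_sign_antisym[of i j] insert_commute)

lemma eps_eps: "\<epsilon> i (\<epsilon> j U) = - \<epsilon> j (\<epsilon> i U)"
proof (subst vec_eq_iff, rule allI)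
  fix K
  show "\<epsilon> i (\<epsilon> j U) $ K = (- \<epsilon> j (\<epsilon> i U)) $ K"
  proof (cases "i \<noteq> j \<and> i \<in> K \<and> j \<in> K")
    case True
    then obtain M where M: "K = insert i (insert j M)" "i \<notin> M" "j \<notin> M"
      by (metis insert_iff mk_disjoint_insert)
    have "insert i (insert j M) - {i} = insert j M" "insert i (insert j M) - {j} = insert i M"
      "insert i M - {i} = M" "insert j M - {j} = M" using True M by auto
    then show ?thesis using True M
      by (simp add: wedge_axis_nth shuffle_sign_insert swap_sign_antisym[of i j])
  qed (auto simp: wedge_axis_nth)
qed

lemma eps_iota_eps: "\<epsilon> a (\<iota> b (\<epsilon> i U)) = \<epsilon> i (\<epsilon> a (\<iota> b U)) + (if i = b then \<epsilon> a U else 0)"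
  unfolding iota_eps ext_linear eps_eps[of a i] by (simp add: ext_linear)

lemma iota_eps_iota: "\<iota> j (\<epsilon> a (\<iota> b U)) = \<epsilon> a (\<iota> b (\<iota> j U)) + (if j = a then \<iota> b U else 0)"
  unfolding iota_eps iota_iota[of j b] by (simp add: linear_neg[OF linear_eps])

definition has_degree :: "nat \<Rightarrow> 'n::{finite,linorder} ext \<Rightarrow> bool"
  where "has_degree l U \<longleftrightarrow> (\<forall>J. card J \<noteq> l \<longrightarrow> U $ J = 0)"

text \<open>
  \<open>\<Sum>\<^sub>i \<epsilon>\<^sub>i \<iota>\<^sub>i\<close> is the number operator of the exterior algebra: the summand \<open>i\<close> projects onto the
  span of those basis vectors in which \<open>\<partial>\<^sub>i\<close> occurs.
\<close>

lemma sum_eps_iota: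
  assumes "has_degree l U"
  shows "(\<Sum>i\<in>UNIV. \<epsilon> i (\<iota> i U)) = real l *\<^sub>R U"
proof (subst vec_eq_iff, rule allI)
  fix J
  have "\<epsilon> i (\<iota> i U) $ J = (if i \<in> J then U $ J else 0)" for i
    by (simp add: wedge_axis_nth contract_nth insert_absorb flip: mult.assoc)
  then have "(\<Sum>i\<in>UNIV. \<epsilon> i (\<iota> i U)) $ J = real (card J) * U $ J"
    by (simp add: sum.If_cases)
  then show "(\<Sum>i\<in>UNIV. \<epsilon> i (\<iota> i U)) $ J = (real l *\<^sub>R U) $ J"
    using assms by (cases "card J = l") (auto simp: has_degree_def)
qed

text \<open>
  The number operator on a contraction. It is computed by commuting \<open>\<iota>\<^sub>j\<close> to the left rather than
  from the degree of \<open>\<iota>\<^sub>j U\<close>, so that \<open>l = 0\<close>, where both sides vanish, is covered as well.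
\<close>

lemma sum_eps_iota_iota:
  assumes "has_degree l U"
  shows "(\<Sum>b\<in>UNIV. \<epsilon> b (\<iota> b (\<iota> j U))) = (real l - 1) *\<^sub>R \<iota> j U"
proof -
  have "(\<Sum>b\<in>UNIV. \<epsilon> b (\<iota> b (\<iota> j U))) = (\<Sum>b\<in>UNIV. \<iota> j (\<epsilon> b (\<iota> b U)) - (if j = b then \<iota> b U else 0))"
    by (simp add: iota_eps_iota)
  also have "\<dots> = \<iota> j (real l *\<^sub>R U) - \<iota> j U"
    by (simp add: sum_subtractf sum_eps_iota[OF assms] flip: ext_linear(9))
  finally show ?thesis by (simp add: ext_linear scaleR_left_diff_distrib)
qed

lemma has_degree_eps_iota:
  assumes "has_degree l U"
  shows "has_degree l (\<epsilon> i (\<iota> j U))"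
  unfolding has_degree_def
proof (intro allI impI)
  fix J :: "'a set" assume J: "card J \<noteq> l"
  show "\<epsilon> i (\<iota> j U) $ J = 0"
  proof (cases "i \<in> J \<and> j \<notin> J - {i}")
    case True
    have "card (insert j (J - {i})) = card J" 
      using True by (metis card_Suc_Diff1 card_insert_disjoint finite)
    then show ?thesis using assms J True by (simp add: wedge_axis_nth contract_nth has_degree_def)
  qed (auto simp: wedge_axis_nth contract_nth)
qed

lemma wedge_axis_right_nth:
  "(W \<and>\<^sub>e axis {m} 1) $ K = (if m \<in> K then shuffle_sign (K - {m}) {m} * W $ (K - {m}) else 0)"
proof -
  have "(W \<and>\<^sub>e axis {m} 1) $ K =
      (\<Sum>I\<in>Pow K. if I = K - {m} then (if m \<in> K then shuffle_sign (K - {m}) {m} * W $ (K - {m}) else 0) else 0)"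
    unfolding wedge_def vec_lambda_beta
  proof (rule sum.cong)
    fix I assume "I \<in> Pow K"
    then have "K - I = {m} \<longleftrightarrow> m \<in> K \<and> I = K - {m}" by auto
    then show "shuffle_sign I (K - I) * W $ I * axis {m} 1 $ (K - I) =
      (if I = K - {m} then (if m \<in> K then shuffle_sign (K - {m}) {m} * W $ (K - {m}) else 0) else 0)"
      by (cases "K - I = {m}") (auto simp: axis_def)
  qed simp
  then show ?thesis by simp
qed

lemma linear_wedge_right: "linear (\<lambda>W. U \<and>\<^sub>e W)"
  by (rule linearI)
     (simp_all add: vec_eq_iff wedge_def distrib_left sum.distrib sum_distrib_left mult_ac)

section \<open>Operators on polynomial poly-vector fields\<close>

text \<open>
  Up to the sign \<open>(-1)\<^bsup>l - 1\<^esup>\<close> this is the trace operator on fields of degree \<open>l\<close>: the index that is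
  differentiated is contracted first instead of last.
\<close>

definition divergence :: "'n::{finite,linorder} ext_field \<Rightarrow> 'n ext_field"  ("\<delta>")
  where "\<delta> A = (\<lambda>x. \<Sum>j\<in>UNIV. \<iota> j (partial j A x))"

definition e0_wedge :: "'n::{finite,linorder} ext_field \<Rightarrow> 'n ext_field"
  where "e0_wedge A = (\<lambda>x. \<Sum>i\<in>UNIV. x $ i *\<^sub>R \<epsilon> i (A x))"

text \<open>
  The action of the matrix unit whose only entry sits in row \<open>a\<close> and column \<open>b\<close>: as a linear vector
  field it is \<open>x\<^sub>b \<partial>\<^sub>a\<close>, with the opposite sign because it acts on coefficients by the dual.
\<close>

definition elementary_act :: "'n::{finite,linorder} \<Rightarrow> 'n \<Rightarrow> 'n ext_field \<Rightarrow> 'n ext_field"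
  where "elementary_act a b A = (\<lambda>x. \<epsilon> a (\<iota> b (A x)) - x $ b *\<^sub>R partial a A x)"

lemmas polynomial_eps = polynomial_linear_comp[OF _ linear_eps]
lemmas polynomial_iota = polynomial_linear_comp[OF _ linear_iota]
lemmas partial_eps = partial_linear[OF _ linear_eps]
lemmas partial_iota = partial_linear[OF _ linear_iota]
lemmas polynomial_scaled = polynomial_function_mult[OF polynomial_coord]

lemma polynomial_divergence:
  "polynomial_function A \<Longrightarrow> polynomial_function (\<delta> A)"
  unfolding divergence_def by (intro polynomial_function_sum finite polynomial_iota polynomial_partial)

lemma polynomial_e0_wedge:
  "polynomial_function A \<Longrightarrow> polynomial_function (e0_wedge A)"
  unfolding e0_wedge_def by (intro polynomial_function_sum finite polynomial_scaled polynomial_eps)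

lemma partial_divergence:
  assumes "polynomial_function A"
  shows "partial m (\<delta> A) x = (\<Sum>j\<in>UNIV. \<iota> j (partial m (partial j A) x))"
  unfolding divergence_def
  by (subst partial_sum) (simp_all add: assms polynomial_iota polynomial_partial partial_iota)

lemma partial_e0_wedge:
  assumes "polynomial_function A"
  shows "partial m (e0_wedge A) x = \<epsilon> m (A x) + (\<Sum>i\<in>UNIV. x $ i *\<^sub>R \<epsilon> i (partial m A x))"
  unfolding e0_wedge_def
  by (subst partial_sum)
     (simp_all add: assms polynomial_scaled polynomial_eps partial_eps partial_coord_scaleR sum.distrib)

lemma partial_elementary_act:
  assumes "polynomial_function A"
  shows "partial m (elementary_act a b A) x =
    \<epsilon> a (\<iota> b (partial m A x)) - (if b = m then partial a A x else 0) - x $ b *\<^sub>R partial m (partial a A) x"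
  unfolding elementary_act_def
  by (subst partial_diff)
     (simp_all add: assms polynomial_scaled polynomial_eps polynomial_iota polynomial_partial
       partial_eps partial_iota partial_coord_scaleR)

text \<open>
  The field \<open>x\<^sup>m \<partial>\<^sub>m\<close> is invariant under \<open>GL(V)\<close>: the term in which \<open>\<iota>\<^sub>b\<close> hits it cancels the term
  in which \<open>\<partial>\<^sub>a\<close> differentiates the coordinate.
\<close>

lemma elementary_act_e0_wedge:
  assumes "polynomial_function A"
  shows "elementary_act a b (e0_wedge A) = e0_wedge (elementary_act a b A)"
proof
  fix x
  have "elementary_act a b (e0_wedge A) x =
      (\<Sum>i\<in>UNIV. x $ i *\<^sub>R \<epsilon> a (\<iota> b (\<epsilon> i (A x)))) -
      x $ b *\<^sub>R (\<epsilon> a (A x) + (\<Sum>i\<in>UNIV. x $ i *\<^sub>R \<epsilon> i (partial a A x)))"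
    unfolding elementary_act_def partial_e0_wedge[OF assms] by (simp add: e0_wedge_def ext_linear)
  also have "(\<Sum>i\<in>UNIV. x $ i *\<^sub>R \<epsilon> a (\<iota> b (\<epsilon> i (A x)))) =
      (\<Sum>i\<in>UNIV. x $ i *\<^sub>R \<epsilon> i (\<epsilon> a (\<iota> b (A x)))) + x $ b *\<^sub>R \<epsilon> a (A x)"
    by (simp add: eps_iota_eps scaleR_right_distrib sum.distrib if_distrib[of "\<lambda>u. _ *\<^sub>R u"] cong: if_cong)
  finally show "elementary_act a b (e0_wedge A) x = e0_wedge (elementary_act a b A) x"
    by (simp add: elementary_act_def e0_wedge_def ext_linear scaleR_right_distrib scaleR_right_diff_distrib
        sum_subtractf scaleR_sum_right mult.commute)
qed

text \<open>
  Contracting the index of a derivative is invariant as well: the defect \<open>\<iota>\<^sub>b \<partial>\<^sub>a\<close> from the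
  anticommutator cancels the one from \<open>\<partial>\<^sub>j x\<^sub>b\<close>.
\<close>

lemma elementary_act_divergence:
  assumes "polynomial_function A"
  shows "elementary_act a b (\<delta> A) = \<delta> (elementary_act a b A)"
proof
  fix x
  have "\<delta> (elementary_act a b A) x =
      (\<Sum>j\<in>UNIV. \<iota> j (\<epsilon> a (\<iota> b (partial j A x)))) - \<iota> b (partial a A x) -
      x $ b *\<^sub>R (\<Sum>j\<in>UNIV. \<iota> j (partial a (partial j A) x))"
    unfolding divergence_def partial_elementary_act[OF assms] partial_commute[OF assms, of _ a]
    by (simp add: ext_linear sum_subtractf scaleR_sum_right if_distrib[of "\<iota> _"] cong: if_cong)
  also have "(\<Sum>j\<in>UNIV. \<iota> j (\<epsilon> a (\<iota> b (partial j A x)))) =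
      (\<Sum>j\<in>UNIV. \<epsilon> a (\<iota> b (\<iota> j (partial j A x)))) + \<iota> b (partial a A x)"
    by (simp add: iota_eps_iota sum.distrib)
  finally show "elementary_act a b (\<delta> A) x = \<delta> (elementary_act a b A) x"
    unfolding elementary_act_def partial_divergence[OF assms] by (simp add: divergence_def ext_linear)
qed

text \<open>
  Second derivatives are symmetric and contractions anticommute, so exchanging the two summation
  indices changes the sign of the sum.
\<close>

lemma divergence_divergence:
  assumes "polynomial_function A"
  shows "\<delta> (\<delta> A) = 0"
proof
  fix x
  let ?s = "\<delta> (\<delta> A) x"
  have "?s = (\<Sum>i\<in>UNIV. \<Sum>j\<in>UNIV. \<iota> i (\<iota> j (partial i (partial j A) x)))"
    by (simp add: divergence_def[of "\<delta> A"] partial_divergence[OF assms] ext_linear)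
  also have "\<dots> = (\<Sum>i\<in>UNIV. \<Sum>j\<in>UNIV. - \<iota> j (\<iota> i (partial j (partial i A) x)))"
    by (intro sum.cong refl, subst iota_iota) (simp only: partial_commute[OF assms])
  also have "\<dots> = (\<Sum>j\<in>UNIV. \<Sum>i\<in>UNIV. - \<iota> j (\<iota> i (partial j (partial i A) x)))"
    by (rule sum.swap)
  also have "\<dots> = - ?s"
    by (simp add: divergence_def[of "\<delta> A"] partial_divergence[OF assms] ext_linear sum_negf)
  finally have "?s + ?s = 0" by (simp only: eq_neg_iff_add_eq_0)
  then have "2 *\<^sub>R ?s = 0" by (simp only: scaleR_2)
  then show "?s = 0 x" by simp
qed

definition Euler_degree :: "nat \<Rightarrow> 'n::{finite,linorder} ext_field \<Rightarrow> bool"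
  where "Euler_degree k A \<longleftrightarrow> (\<forall>x. (\<Sum>i\<in>UNIV. x $ i *\<^sub>R partial i A x) = real k *\<^sub>R A x)"

text \<open>
  The degree \<open>k - 1\<close> of the derivative is a real number here; it follows from differentiating the
  Euler identity and stays correct for \<open>k = 0\<close>, where it would be truncated as a natural number.
\<close>

lemma Euler_partial:
  assumes "polynomial_function A" "Euler_degree k A"
  shows "(\<Sum>i\<in>UNIV. x $ i *\<^sub>R partial i (partial j A) x) = (real k - 1) *\<^sub>R partial j A x"
proof -
  have "partial j (\<lambda>x. \<Sum>i\<in>UNIV. x $ i *\<^sub>R partial i A x) x =
      partial j A x + (\<Sum>i\<in>UNIV. x $ i *\<^sub>R partial i (partial j A) x)"
    unfolding partial_commute[OF assms(1), of _ j]
    by (subst partial_sum)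
       (simp_all add: polynomial_scaled polynomial_partial assms partial_coord_scaleR sum.distrib)
  moreover have "(\<lambda>x. \<Sum>i\<in>UNIV. x $ i *\<^sub>R partial i A x) = (\<lambda>x. real k *\<^sub>R A x)"
    using assms(2) by (simp add: Euler_degree_def)
  moreover have "partial j (\<lambda>x. real k *\<^sub>R A x) x = real k *\<^sub>R partial j A x"
    by (rule partial_linear[OF assms(1)]) (rule linear_scaleR)
  ultimately show ?thesis by (simp add: algebra_simps)
qed

lemma Euler_divergence:
  assumes "polynomial_function A" "Euler_degree k A"
  shows "(\<Sum>i\<in>UNIV. x $ i *\<^sub>R partial i (\<delta> A) x) = (real k - 1) *\<^sub>R \<delta> A x"
proof -
  have "(\<Sum>i\<in>UNIV. x $ i *\<^sub>R partial i (\<delta> A) x) =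
      (\<Sum>j\<in>UNIV. \<iota> j (\<Sum>i\<in>UNIV. x $ i *\<^sub>R partial i (partial j A) x))"
    unfolding partial_divergence[OF assms(1)] scaleR_sum_right ext_linear by (rule sum.swap)
  then show ?thesis
    by (simp add: Euler_partial[OF assms] ext_linear divergence_def scaleR_sum_right)
qed

text \<open>
  Write \<open>e = \<Sum> x\<^sub>i \<epsilon>\<^sub>i\<close> and \<open>\<delta> = \<Sum> \<iota>\<^sub>j \<partial>\<^sub>j\<close>. The relations give \<open>\<delta> e + e \<delta> = n - N + E\<close> with the number
  operator \<open>N\<close> and the Euler operator \<open>E\<close>. Applied to \<open>B = \<delta> A\<close>, where \<open>\<delta> B = 0\<close>, \<open>N = l - 1\<close> and
  \<open>E = k - 1\<close>, the right-hand side is \<open>n + k - l\<close>; this is where the normalisation of \<open>e\<^bsup>(k,l)\<^esup>\<close> comes from.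
\<close>

lemma divergence_e0_wedge_divergence:
  fixes A :: "'n::{finite,linorder} ext_field"
  assumes "polynomial_function A" "Euler_degree k A" "\<And>x m. has_degree l (partial m A x)"
  shows "\<delta> (e0_wedge (\<delta> A)) x = (real CARD('n) + real k - real l) *\<^sub>R \<delta> A x"
proof -
  let ?B = "\<delta> A"
  have B: "polynomial_function ?B" using assms(1) by (rule polynomial_divergence)
  have N: "(\<Sum>j\<in>UNIV. \<epsilon> j (\<iota> j (?B x))) = (real l - 1) *\<^sub>R ?B x"
    unfolding divergence_def ext_linear
    by (subst sum.swap) (simp add: sum_eps_iota_iota[OF assms(3)] scaleR_sum_right)
  have "\<delta> (e0_wedge ?B) x = (\<Sum>j\<in>UNIV. \<iota> j (\<epsilon> j (?B x))) +
      (\<Sum>j\<in>UNIV. \<Sum>i\<in>UNIV. x $ i *\<^sub>R \<iota> j (\<epsilon> i (partial j ?B x)))"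
    by (simp add: divergence_def[of "e0_wedge _"] partial_e0_wedge[OF B] ext_linear sum.distrib)
  also have "(\<Sum>j\<in>UNIV. \<iota> j (\<epsilon> j (?B x))) = (real CARD('n) - real l + 1) *\<^sub>R ?B x"
    by (simp add: iota_eps sum_subtractf N sum_constant_scaleR algebra_simps del: sum_constant)
  also have "(\<Sum>j\<in>UNIV. \<Sum>i\<in>UNIV. x $ i *\<^sub>R \<iota> j (\<epsilon> i (partial j ?B x))) =
      (\<Sum>j\<in>UNIV. x $ j *\<^sub>R partial j ?B x) - (\<Sum>j\<in>UNIV. \<Sum>i\<in>UNIV. x $ i *\<^sub>R \<epsilon> i (\<iota> j (partial j ?B x)))"
    by (simp add: iota_eps scaleR_right_diff_distrib sum_subtractf if_distrib[of "\<lambda>u. _ *\<^sub>R u"] cong: if_cong)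
  also have "(\<Sum>j\<in>UNIV. \<Sum>i\<in>UNIV. x $ i *\<^sub>R \<epsilon> i (\<iota> j (partial j ?B x))) = e0_wedge (\<delta> ?B) x"
    unfolding e0_wedge_def divergence_def[of ?B] ext_linear scaleR_sum_right by (rule sum.swap)
  also have "\<dots> = 0"
    by (simp add: divergence_divergence[OF assms(1)] e0_wedge_def ext_linear)
  finally show ?thesis
    by (simp add: Euler_divergence[OF assms(1,2)] algebra_simps)
qed

text \<open>
  The Casimir operator \<open>\<Sum> E\<^sub>a\<^sub>b E\<^sub>b\<^sub>a\<close> of the general linear algebra. The purely exterior and the purely
  polynomial parts are scalars on fields of bidegree \<open>(k, l)\<close>, and each of the two mixed parts is
  \<open>-e \<delta>\<close>. So on these fields \<open>e \<delta>\<close> can be expressed by the action of matrices alone.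
\<close>

lemma Casimir:
  fixes A :: "'n::{finite,linorder} ext_field"
  assumes "polynomial_function A" "Euler_degree k A" "\<And>x. has_degree l (A x)"
  shows "(\<Sum>a\<in>UNIV. \<Sum>b\<in>UNIV. elementary_act a b (elementary_act b a A) x) =
    (real l * (real CARD('n) - real l + 1) + real k * (real CARD('n) + real k - 1)) *\<^sub>R A x
      - 2 *\<^sub>R e0_wedge (\<delta> A) x"
proof -
  let ?n = "real CARD('n)"
  have 1: "(\<Sum>a\<in>UNIV. \<Sum>b\<in>UNIV. \<epsilon> a (\<iota> b (\<epsilon> b (\<iota> a (A x))))) = (real l * (?n - real l + 1)) *\<^sub>R A x"
  proof -
    have "(\<Sum>b\<in>UNIV. \<iota> b (\<epsilon> b (\<iota> a (A x)))) = (?n - real l + 1) *\<^sub>R \<iota> a (A x)" for a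
      by (simp add: iota_eps sum_subtractf sum_eps_iota_iota[OF assms(3)] sum_constant_scaleR algebra_simps del: sum_constant)
    then have "(\<Sum>b\<in>UNIV. \<epsilon> a (\<iota> b (\<epsilon> b (\<iota> a (A x))))) = (?n - real l + 1) *\<^sub>R \<epsilon> a (\<iota> a (A x))" for a
      by (simp add: ext_linear flip: ext_linear(4))
    then show ?thesis
      by (simp add: sum_eps_iota[OF assms(3)] flip: scaleR_sum_right)
  qed
  have 2: "(\<Sum>a\<in>UNIV. \<Sum>b\<in>UNIV. x $ a *\<^sub>R \<epsilon> a (\<iota> b (partial b A x))) = e0_wedge (\<delta> A) x"
    by (simp add: e0_wedge_def divergence_def ext_linear scaleR_sum_right)
  have 3: "(\<Sum>a\<in>UNIV. \<Sum>b\<in>UNIV. x $ b *\<^sub>R \<epsilon> b (\<iota> a (partial a A x))) = e0_wedge (\<delta> A) x"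
    by (subst sum.swap) (rule 2)
  have 4: "(\<Sum>a\<in>(UNIV::'n set). \<Sum>b\<in>UNIV. x $ b *\<^sub>R partial b A x) = (?n * real k) *\<^sub>R A x"
    using assms(2) by (simp add: Euler_degree_def sum_constant_scaleR del: sum_constant)
  have 5: "(\<Sum>a\<in>UNIV. \<Sum>b\<in>UNIV. (x $ b * x $ a) *\<^sub>R partial a (partial b A) x) = ((real k - 1) * real k) *\<^sub>R A x"
  proof -
    have "(\<Sum>a\<in>UNIV. \<Sum>b\<in>UNIV. (x $ b * x $ a) *\<^sub>R partial a (partial b A) x) =
        (\<Sum>b\<in>UNIV. x $ b *\<^sub>R (\<Sum>a\<in>UNIV. x $ a *\<^sub>R partial a (partial b A) x))"
      by (subst sum.swap) (simp add: scaleR_sum_right)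
    also have "\<dots> = (real k - 1) *\<^sub>R (\<Sum>b\<in>UNIV. x $ b *\<^sub>R partial b A x)"
      by (simp add: Euler_partial[OF assms(1,2)] scaleR_sum_right mult.commute)
    finally show ?thesis using assms(2) by (simp add: Euler_degree_def)
  qed
  have "elementary_act a b (elementary_act b a A) x =
      \<epsilon> a (\<iota> b (\<epsilon> b (\<iota> a (A x)))) - x $ a *\<^sub>R \<epsilon> a (\<iota> b (partial b A x))
      - x $ b *\<^sub>R \<epsilon> b (\<iota> a (partial a A x)) + x $ b *\<^sub>R partial b A x
      + (x $ b * x $ a) *\<^sub>R partial a (partial b A) x" for a b
    by (subst elementary_act_def, subst partial_elementary_act[OF assms(1)])
       (simp add: elementary_act_def ext_linear algebra_simps)
  then show ?thesis
    by (simp only: sum.distrib sum_subtractf 1 2 3 4 5) (simp add: algebra_simps scaleR_2)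
qed

section \<open>The spaces \<open>\<PP> k l\<close>\<close>

lemma poly_field_iff:
  "A \<in> \<PP> k l \<longleftrightarrow> (\<forall>J. homogeneous k (\<lambda>x. A x $ J)) \<and> (\<forall>x. has_degree l (A x))"
  by (auto simp: poly_field_def homogeneous_poly_iff has_degree_def)

lemma poly_field_polynomial: "A \<in> \<PP> k l \<Longrightarrow> polynomial_function A"
  by (auto simp: poly_field_iff polynomial_function_vec_iff intro: homogeneous_polynomial)

lemma poly_field_degree: "A \<in> \<PP> k l \<Longrightarrow> has_degree l (A x)"
  by (simp add: poly_field_iff)

text \<open>
  A field of degree \<open>l\<close> takes values in a fixed linear subspace, hence so do its derivatives.
\<close>

lemma poly_field_degree_partial:
  assumes "A \<in> \<PP> k l"
  shows "has_degree l (partial m A x)"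
proof -
  have "(\<lambda>x. A x $ J) = (\<lambda>_. 0)" if "card J \<noteq> l" for J
    using assms that by (simp add: poly_field_def)
  then show ?thesis
    by (simp add: has_degree_def partial_nth poly_field_polynomial[OF assms])
qed

lemma poly_field_Euler:
  assumes "A \<in> \<PP> k l"
  shows "Euler_degree k A"
  using assms homogeneous_Euler
  by (auto simp: Euler_degree_def vec_eq_iff partial_nth poly_field_polynomial poly_field_iff)

lemma subspace_poly_field: "subspace (\<PP> k l)"
  by (rule subspaceI)
     (auto simp: poly_field_iff has_degree_def scaleR_fun_def
       intro: homogeneous.zero homogeneous.add homogeneous_scale)

lemma subspace_sum_pointwise:
  fixes F :: "'i \<Rightarrow> 'a \<Rightarrow> 'b::real_vector"
  assumes "subspace W" "\<And>i. i \<in> S \<Longrightarrow> F i \<in> W"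
  shows "(\<lambda>x. \<Sum>i\<in>S. F i x) \<in> W"
proof -
  have "(\<Sum>i\<in>S. F i) x = (\<Sum>i\<in>S. F i x)" for x
    by (induction S rule: infinite_finite_induct) auto
  then have "(\<lambda>x. \<Sum>i\<in>S. F i x) = (\<Sum>i\<in>S. F i)" by auto
  then show ?thesis using subspace_sum[OF assms] by simp
qed

lemma subspace_scaleR_pointwise:
  "subspace W \<Longrightarrow> F \<in> W \<Longrightarrow> (\<lambda>x. c *\<^sub>R F x) \<in> W"
  using subspace_scale[of W F c] by (simp add: scaleR_fun_def)

lemma subspace_diff_pointwise:
  "subspace W \<Longrightarrow> F \<in> W \<Longrightarrow> G \<in> W \<Longrightarrow> (\<lambda>x. F x - G x) \<in> W"
  using subspace_diff[of W F G] by (simp add: fun_diff_def)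

lemma eps_iota_poly_field:
  assumes "A \<in> \<PP> k l"
  shows "(\<lambda>x. \<epsilon> a (\<iota> b (A x))) \<in> \<PP> k l"
  unfolding poly_field_iff
proof (intro conjI allI)
  fix J
  have hom: "homogeneous k (\<lambda>x. A x $ K)" for K
    using assms by (simp add: poly_field_iff)
  show "homogeneous k (\<lambda>x. \<epsilon> a (\<iota> b (A x)) $ J)"
    by (cases "a \<in> J"; cases "b \<in> J - {a}")
       (simp_all add: wedge_axis_nth contract_nth homogeneous.zero homogeneous_scale hom del: Diff_iff)
qed (use assms in \<open>simp add: poly_field_iff has_degree_eps_iota\<close>)

lemma coord_partial_poly_field:
  assumes "A \<in> \<PP> k l"
  shows "(\<lambda>x. x $ i *\<^sub>R partial j A x) \<in> \<PP> k l"
  using assms poly_field_degree_partial[OF assms] unfolding poly_field_iff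
  by (auto simp: partial_nth poly_field_polynomial[OF assms] homogeneous_partial has_degree_def)

lemma elementary_act_poly_field: "A \<in> \<PP> k l \<Longrightarrow> elementary_act a b A \<in> \<PP> k l"
  unfolding elementary_act_def
  by (intro subspace_diff_pointwise subspace_poly_field eps_iota_poly_field coord_partial_poly_field)

lemma e0_wedge_divergence_poly_field:
  assumes "A \<in> \<PP> k l"
  shows "e0_wedge (\<delta> A) \<in> \<PP> k l"
proof -
  have "e0_wedge (\<delta> A) = (\<lambda>x. \<Sum>i\<in>UNIV. \<Sum>j\<in>UNIV. \<epsilon> i (\<iota> j (x $ i *\<^sub>R partial j A x)))"
    by (simp add: fun_eq_iff e0_wedge_def divergence_def ext_linear scaleR_sum_right)
  moreover have "\<dots> \<in> \<PP> k l"
    by (intro subspace_sum_pointwise subspace_poly_field eps_iota_poly_field coord_partial_poly_field assms)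
  ultimately show ?thesis by simp
qed

lemma homogeneous_0_imp_const: "homogeneous 0 f \<Longrightarrow> \<exists>c. f = (\<lambda>_. c)"
  by (induction "0 :: nat" f rule: homogeneous.induct) auto

text \<open>
  If \<open>n + k - l = 0\<close> then either \<open>k = 0\<close>, and the coefficients are constant, or \<open>l > n\<close>, and the field
  vanishes. This makes the case in which \<open>e\<^bsup>(k,l)\<^esup>\<close> has the factor \<open>1 / 0 = 0\<close> consistent with the others.
\<close>

lemma divergence_zero:
  assumes "A \<in> \<PP> k l" "CARD('n) + k = l"
  shows "\<delta> A = (0 :: 'n::{finite,linorder} ext_field)"
proof -
  have A: "polynomial_function A" using assms(1) by (rule poly_field_polynomial)
  have "partial m A x $ J = 0" for m x J
  proof (cases "k = 0")
    case True
    then have "homogeneous 0 (\<lambda>x. A x $ J)" using assms by (simp add: poly_field_iff)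
    then obtain c where "(\<lambda>x. A x $ J) = (\<lambda>_. c)" using homogeneous_0_imp_const by blast
    then show ?thesis by (simp add: partial_nth A)
  next
    case False
    then have "card J \<noteq> l" using card_mono[OF finite, of J UNIV] assms(2) by auto
    then show ?thesis using poly_field_degree_partial[OF assms(1)] by (simp add: has_degree_def)
  qed
  then have "partial m A x = 0" for m x by (simp add: vec_eq_iff)
  then show ?thesis by (simp add: fun_eq_iff divergence_def ext_linear)
qed

section \<open>Identification of the trace and the action of matrices\<close>

lemma trace_op_eq_divergence:
  assumes "polynomial_function A"
  shows "trace_op A x $ J = (- 1) ^ card J * \<delta> A x $ J"
proof -
  have "trace_op A x $ J = (\<Sum>m\<in>- J. (- 1) ^ card J * \<iota> m (partial m A x) $ J)"
    unfolding trace_op_nth[OF differentiable_at_polynomial_function[OF assms]]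
    by (intro sum.cong refl) (simp add: contract_nth shuffle_sign_singleton_right)
  also have "\<dots> = (- 1) ^ card J * (\<Sum>m\<in>UNIV. \<iota> m (partial m A x) $ J)"
    unfolding sum_distrib_left by (intro sum.mono_neutral_left) (auto simp: contract_nth)
  finally show ?thesis by (simp add: divergence_def)
qed

lemma trace_op_zero_iff:
  "polynomial_function A \<Longrightarrow> trace_op A = 0 \<longleftrightarrow> \<delta> A = 0"
  by (simp add: fun_eq_iff vec_eq_iff trace_op_eq_divergence)

text \<open>
  The sign by which \<open>trace_op\<close> differs from \<open>\<delta>\<close> in the component \<open>J\<close> is the sign of moving a vector
  past \<open>\<partial>\<^sub>J\<close>. Multiplying by \<open>x\<^sup>m \<partial>\<^sub>m\<close> from the right instead of the left produces it a second time.
\<close>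

lemma trace_op_wedge_e_field:
  fixes A :: "'n::{finite,linorder} ext_field"
  assumes "polynomial_function A"
  shows "trace_op A \<and>\<^sub>f e_field k l = (1 / (real CARD('n) + real k - real l)) *\<^sub>R e0_wedge (\<delta> A)"
proof
  fix x
  have *: "trace_op A x \<and>\<^sub>e axis {m} 1 = \<epsilon> m (\<delta> A x)" for m
  proof (subst vec_eq_iff, rule allI)
    fix K
    show "(trace_op A x \<and>\<^sub>e axis {m} 1) $ K = \<epsilon> m (\<delta> A x) $ K"
      using shuffle_sign_singleton_right[of m "K - {m}"]
      by (simp add: wedge_axis_right_nth wedge_axis_nth trace_op_eq_divergence[OF assms]
          mult_ac flip: power_add mult_2)
  qed
  show "(trace_op A \<and>\<^sub>f e_field k l) x =
      ((1 / (real CARD('n) + real k - real l)) *\<^sub>R e0_wedge (\<delta> A)) x"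
    by (simp add: wedge_field_def e_field_def e0_field_def scaleR_fun_def e0_wedge_def *
        linear_scale[OF linear_wedge_right] linear_sum[OF linear_wedge_right])
qed

lemma mat_act_eq:
  assumes "polynomial_function A"
  shows "mat_act M A = (\<lambda>x. \<Sum>i\<in>UNIV. \<Sum>j\<in>UNIV. M $ i $ j *\<^sub>R elementary_act i j A x)"
  unfolding mat_act_def directional_derivative[OF assms]
  by (simp add: fun_eq_iff ext_derivation_def elementary_act_def matrix_vector_mult_def scaleR_sum_left
      scaleR_right_diff_distrib sum_subtractf)

lemma sum_elementary_act_diagonal:
  assumes "A \<in> \<PP> k l"
  shows "(\<Sum>i\<in>UNIV. elementary_act i i A x) = (real l - real k) *\<^sub>R A x"
  using sum_eps_iota[OF poly_field_degree[OF assms]] poly_field_Euler[OF assms]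
  by (simp add: elementary_act_def sum_subtractf Euler_degree_def scaleR_left_diff_distrib)

text \<open>
  The identity matrix acts on \<open>\<PP> k l\<close> by the scalar \<open>l - k\<close>, so a subspace that is invariant under the
  traceless matrices is invariant under all matrices.
\<close>

lemma sl_invariant_imp_elementary:
  assumes "subspace W" "W \<subseteq> \<PP> k l" "sl_invariant W" "A \<in> W"
  shows "elementary_act a b A \<in> (W :: 'n::{finite,linorder} ext_field set)"
proof -
  have A: "A \<in> \<PP> k l" "polynomial_function A" using assms poly_field_polynomial by auto
  \<comment> \<open>the multiple of the identity that makes the matrix unit traceless\<close>
  define t where "t = (if a = b then 1 / real CARD('n) else 0)"
  define M :: "real ^ 'n::{finite,linorder} ^ 'n::{finite,linorder}"
    where "M = (\<chi> i j. (if i = a \<and> j = b then 1 else 0) - (if i = j then t else 0))"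
  have "trace M = (\<Sum>i\<in>UNIV. (if i = a then if a = b then 1 else 0 else 0) - t)"
    unfolding trace_def M_def by (intro sum.cong) auto
  then have "trace M = 0" by (simp add: sum_subtractf t_def)
  then have 1: "mat_act M A \<in> W" using assms unfolding sl_invariant_def by blast
  have "mat_act M A x = elementary_act a b A x - (t * (real l - real k)) *\<^sub>R A x" for x
  proof -
    have "mat_act M A x = (\<Sum>i\<in>UNIV. \<Sum>j\<in>UNIV.
        (if j = b then if i = a then elementary_act i j A x else 0 else 0)
         - (if i = j then t *\<^sub>R elementary_act i j A x else 0))"
      unfolding mat_act_eq[OF A(2)] M_def by (intro sum.cong refl) (auto simp: scaleR_left_diff_distrib)
    also have "\<dots> = elementary_act a b A x - t *\<^sub>R (\<Sum>i\<in>UNIV. elementary_act i i A x)"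
      by (simp add: sum_subtractf scaleR_sum_right)
    finally show ?thesis by (simp add: sum_elementary_act_diagonal[OF A(1)])
  qed
  then have "elementary_act a b A = mat_act M A + (t * (real l - real k)) *\<^sub>R A"
    by (simp add: fun_eq_iff scaleR_fun_def)
  then show ?thesis using 1 assms by (simp add: subspace_add subspace_scale)
qed

section \<open>The invariant complement\<close>

lemma divergence_add:
  "polynomial_function A \<Longrightarrow> polynomial_function B \<Longrightarrow> \<delta> (A + B) = \<delta> A + \<delta> B"
  by (simp add: fun_eq_iff plus_fun_def divergence_def partial_add ext_linear sum.distrib)

lemma divergence_scale: "polynomial_function A \<Longrightarrow> \<delta> (c *\<^sub>R A) = c *\<^sub>R \<delta> A"
  by (simp add: fun_eq_iff scaleR_fun_def divergence_def partial_linear[OF _ linear_scaleR]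
      ext_linear scaleR_sum_right)

lemma e0_wedge_add: "e0_wedge (A + B) = e0_wedge A + e0_wedge B"
  by (simp add: fun_eq_iff e0_wedge_def ext_linear scaleR_right_distrib sum.distrib)

lemma e0_wedge_scale: "e0_wedge (c *\<^sub>R A) = c *\<^sub>R e0_wedge A"
  by (simp add: fun_eq_iff scaleR_fun_def e0_wedge_def ext_linear scaleR_sum_right mult.commute)

lemma e0_wedge_zero: "e0_wedge 0 = 0"
  by (simp add: fun_eq_iff e0_wedge_def ext_linear)

text \<open>
  The candidate \<open>DA \<and> e\<^bsup>(k,l)\<^esup>\<close> for \<open>A\<^sub>1\<close>, in terms of \<open>\<delta>\<close>. It turns out to be a projection that
  commutes with the action of matrices and whose kernel is \<open>trace_free k l\<close>.
\<close>

definition trace_part :: "nat \<Rightarrow> nat \<Rightarrow> 'n::{finite,linorder} ext_field \<Rightarrow> 'n ext_field"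
  where "trace_part k l A = (1 / (real CARD('n) + real k - real l)) *\<^sub>R e0_wedge (\<delta> A)"

lemma trace_part_poly_field: "A \<in> \<PP> k l \<Longrightarrow> trace_part k l A \<in> \<PP> k l"
  unfolding trace_part_def
  by (intro subspace_scale subspace_poly_field e0_wedge_divergence_poly_field)

lemma trace_part_add:
  "A \<in> \<PP> k l \<Longrightarrow> B \<in> \<PP> k l \<Longrightarrow> trace_part k l (A + B) = trace_part k l A + trace_part k l B"
  by (simp add: trace_part_def divergence_add poly_field_polynomial e0_wedge_add scaleR_right_distrib)

lemma trace_part_scale:
  "A \<in> \<PP> k l \<Longrightarrow> trace_part k l (c *\<^sub>R A) = c *\<^sub>R trace_part k l A"
  by (simp add: trace_part_def divergence_scale poly_field_polynomial e0_wedge_scale)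

lemma e0_wedge_divergence_eq_trace_part:
  fixes A :: "'n::{finite,linorder} ext_field"
  assumes "A \<in> \<PP> k l"
  shows "e0_wedge (\<delta> A) = (real CARD('n) + real k - real l) *\<^sub>R trace_part k l A"
proof (cases "CARD('n) + k = l")
  case True
  then show ?thesis using divergence_zero[OF assms True] by (simp add: e0_wedge_zero trace_part_def)
next
  case False
  then have "real CARD('n) + real k - real l \<noteq> 0" by linarith
  then show ?thesis by (simp add: trace_part_def)
qed

lemma divergence_trace_part:
  fixes A :: "'n::{finite,linorder} ext_field"
  assumes "A \<in> \<PP> k l"
  shows "\<delta> (trace_part k l A) = \<delta> A"
proof -
  have A: "polynomial_function A" using assms by (rule poly_field_polynomial)
  have "\<delta> (trace_part k l A) =
      (1 / (real CARD('n) + real k - real l)) *\<^sub>R \<delta> (e0_wedge (\<delta> A))"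
    by (simp add: trace_part_def divergence_scale polynomial_e0_wedge polynomial_divergence A)
  also have "\<delta> (e0_wedge (\<delta> A)) = (real CARD('n) + real k - real l) *\<^sub>R \<delta> A"
    using divergence_e0_wedge_divergence[OF A poly_field_Euler[OF assms] poly_field_degree_partial[OF assms]]
    by (simp add: fun_eq_iff scaleR_fun_def)
  finally have *: "\<delta> (trace_part k l A) = (1 / (real CARD('n) + real k - real l)) *\<^sub>R
      (real CARD('n) + real k - real l) *\<^sub>R \<delta> A" .
  show ?thesis
  proof (cases "CARD('n) + k = l")
    case True
    then show ?thesis using divergence_zero[OF assms True] * by simp
  next
    case False
    then have "real CARD('n) + real k - real l \<noteq> 0" by linarith
    then show ?thesis using * by simp
  qed
qed

lemma trace_free_iff: "A \<in> trace_free k l \<longleftrightarrow> A \<in> \<PP> k l \<and> \<delta> A = 0"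
  by (auto simp: trace_free_def trace_op_zero_iff poly_field_polynomial)

lemma trace_part_trace_free: "A \<in> trace_free k l \<Longrightarrow> trace_part k l A = 0"
  by (simp add: trace_free_iff trace_part_def e0_wedge_zero)

lemma minus_trace_part_trace_free:
  assumes "A \<in> \<PP> k l"
  shows "A - trace_part k l A \<in> trace_free k l"
proof -
  have T: "trace_part k l A \<in> \<PP> k l" using assms by (rule trace_part_poly_field)
  have "A - trace_part k l A = A + (- 1) *\<^sub>R trace_part k l A" by simp
  moreover have "(- 1) *\<^sub>R trace_part k l A \<in> \<PP> k l"
    using T by (intro subspace_scale subspace_poly_field)
  ultimately have "\<delta> (A - trace_part k l A) = \<delta> A + (- 1) *\<^sub>R \<delta> (trace_part k l A)"
    using assms T by (simp only: divergence_add divergence_scale poly_field_polynomial)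
  then show ?thesis
    using assms T by (simp add: trace_free_iff divergence_trace_part subspace_diff subspace_poly_field)
qed

lemma elementary_act_scale:
  assumes "polynomial_function A"
  shows "elementary_act a b (c *\<^sub>R A) = c *\<^sub>R elementary_act a b A"
  by (simp add: fun_eq_iff scaleR_fun_def elementary_act_def partial_linear[OF assms linear_scaleR]
      ext_linear scaleR_right_diff_distrib mult.commute)

lemma trace_part_elementary_act:
  assumes "A \<in> \<PP> k l"
  shows "elementary_act a b (trace_part k l A) = trace_part k l (elementary_act a b A)"
proof -
  have A: "polynomial_function A" using assms by (rule poly_field_polynomial)
  then show ?thesis
    by (simp add: trace_part_def elementary_act_scale elementary_act_e0_wedge elementary_act_divergence
        polynomial_e0_wedge polynomial_divergence)
qed

text \<open>
  The range of the projection, written as its set of fixed points.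
\<close>

definition trace_image :: "nat \<Rightarrow> nat \<Rightarrow> 'n::{finite,linorder} ext_field set"
  where "trace_image k l = {A \<in> \<PP> k l. trace_part k l A = A}"

lemma subspace_trace_image: "subspace (trace_image k l :: 'n::{finite,linorder} ext_field set)"
proof (rule subspaceI)
  have "(0 :: 'n ext_field) \<in> \<PP> k l" using subspace_0[OF subspace_poly_field] .
  then show "(0 :: 'n ext_field) \<in> trace_image k l"
    using trace_part_scale[of "0 :: 'n ext_field" k l 0] by (simp add: trace_image_def)
qed (auto simp: trace_image_def trace_part_add trace_part_scale
      intro: subspace_add subspace_scale subspace_poly_field)

lemma trace_part_idem:
  assumes "A \<in> \<PP> k l"
  shows "trace_part k l (trace_part k l A) = trace_part k l A"
  by (simp only: trace_part_def[of k l "trace_part k l A"] divergence_trace_part[OF assms])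
     (simp only: trace_part_def)

lemma invariant_complement_trace_image:
  "invariant_complement k l (trace_image k l :: 'n::{finite,linorder} ext_field set)"
  unfolding invariant_complement_def
proof (intro conjI ballI)
  let ?W = "trace_image k l :: 'n ext_field set"
  show sub: "subspace ?W" by (rule subspace_trace_image)
  show P: "?W \<subseteq> \<PP> k l" by (auto simp: trace_image_def)
  show "sl_invariant ?W"
    unfolding sl_invariant_def
  proof (intro allI ballI impI)
    fix M :: "real ^ 'n::{finite,linorder} ^ 'n::{finite,linorder}" and A :: "'n ext_field"
    assume A: "A \<in> ?W"
    then have "elementary_act i j A \<in> ?W" for i j
      using trace_part_elementary_act[of A k l i j] by (simp add: trace_image_def elementary_act_poly_field)
    then show "mat_act M A \<in> ?W"
      unfolding mat_act_eq[OF poly_field_polynomial[OF subsetD[OF P A]]]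
      by (intro subspace_sum_pointwise subspace_scaleR_pointwise sub)
  qed
  show "trace_free k l \<inter> ?W = {0}"
  proof
    show "trace_free k l \<inter> ?W \<subseteq> {0}"
    proof
      fix A assume "A \<in> trace_free k l \<inter> ?W"
      then have "trace_part k l A = 0" "trace_part k l A = A"
        by (auto simp only: trace_image_def trace_part_trace_free)
      then show "A \<in> {0}" by simp
    qed
    have 0: "(0 :: 'n ext_field) \<in> \<PP> k l" by (rule subspace_0[OF subspace_poly_field])
    then have "(0 :: 'n ext_field) \<in> trace_free k l"
      using divergence_scale[OF poly_field_polynomial[OF 0], of 0] by (simp add: trace_free_iff)
    then show "{0} \<subseteq> trace_free k l \<inter> ?W" using subspace_0[OF sub] by simp
  qed
  fix A :: "'n ext_field" assume A: "A \<in> \<PP> k l"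
  then have "trace_part k l A \<in> ?W"
    by (simp add: trace_image_def trace_part_poly_field trace_part_idem)
  then show "\<exists>A0\<in>trace_free k l. \<exists>A1\<in>?W. A = A0 + A1"
    using minus_trace_part_trace_free[OF A] by (metis diff_add_cancel)
qed

text \<open>
  The Casimir operator maps \<open>W\<close> into itself and is \<open>c - 2 (n + k - l)\<close> times the projection. If
  \<open>n + k - l \<noteq> 0\<close>, the projection can therefore be recovered from it, and otherwise the projection is
  zero. In terms of representations: the Casimir operator takes different values on the two summands,
  so they have no isomorphic parts and \<open>W\<close> is the sum of its intersections with them.
\<close>

lemma trace_part_mem_invariant:
  fixes W :: "'n::{finite,linorder} ext_field set"
  assumes "subspace W" "W \<subseteq> \<PP> k l" "sl_invariant W" "A \<in> W"
  shows "trace_part k l A \<in> W"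
proof -
  have A: "A \<in> \<PP> k l" using assms by auto
  define s where "s = real CARD('n) + real k - real l"
  define c where "c = real l * (real CARD('n) - real l + 1) + real k * (real CARD('n) + real k - 1)"
  have "(\<lambda>x. \<Sum>a\<in>UNIV. \<Sum>b\<in>UNIV. elementary_act a b (elementary_act b a A) x) \<in> W"
    by (intro subspace_sum_pointwise sl_invariant_imp_elementary[OF assms(1-3)] assms)
  then have "c *\<^sub>R A - (2 * s) *\<^sub>R trace_part k l A \<in> W"
    unfolding Casimir[OF poly_field_polynomial[OF A] poly_field_Euler[OF A] poly_field_degree[OF A]]
      e0_wedge_divergence_eq_trace_part[OF A] c_def s_def
    by (simp add: scaleR_fun_def fun_diff_def)
  from subspace_diff[OF assms(1) subspace_scale[OF assms(1,4), of c] this]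
  have *: "(2 * s) *\<^sub>R trace_part k l A \<in> W" by simp
  show ?thesis
  proof (cases "s = 0")
    case True
    then show ?thesis using subspace_0[OF assms(1)] by (simp add: trace_part_def s_def)
  next
    case False
    then show ?thesis using subspace_scale[OF assms(1) *, of "1 / (2 * s)"] by simp
  qed
qed

text \<open>
  An invariant complement is stable under the projection. For \<open>A\<close> in it, the difference of \<open>A\<close> and its
  projection is trace free and lies in the complement, hence is zero. So every complement is contained
  in the range of the projection, and two nested complements of the same subspace coincide.
\<close>

lemma trace_summand_eq: "trace_summand k l = trace_image k l"
  unfolding trace_summand_def
proof (rule the_equality)
  show "invariant_complement k l (trace_image k l)" by (rule invariant_complement_trace_image)
next
  fix W :: "'n::{finite,linorder} ext_field set"
  assume W: "invariant_complement k l W"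
  note * = W[unfolded invariant_complement_def]
  have sub: "W \<subseteq> trace_image k l"
  proof
    fix A assume A: "A \<in> W"
    then have P: "A \<in> \<PP> k l" using * by auto
    have "A - trace_part k l A \<in> W"
      using * A by (intro subspace_diff trace_part_mem_invariant) auto
    then have "A - trace_part k l A = 0"
      using minus_trace_part_trace_free[OF P] * by blast
    then show "A \<in> trace_image k l" using P by (simp add: trace_image_def)
  qed
  moreover have "trace_image k l \<subseteq> W"
  proof
    fix B :: "'n ext_field" assume B: "B \<in> trace_image k l"
    then obtain A0 A1 where A: "A0 \<in> trace_free k l" "A1 \<in> W" "B = A0 + A1"
      using * by (auto simp: trace_image_def)
    have "B - A1 \<in> trace_image k l"
      using subspace_diff[OF subspace_trace_image B subsetD[OF sub A(2)]] .
    then have "A0 \<in> trace_image k l" by (simp add: A(3))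
    then have "A0 = 0" using trace_part_trace_free[OF A(1)] by (simp add: trace_image_def)
    then show "B \<in> W" using A by simp
  qed
  ultimately show "W = trace_image k l" by auto
qed

lemma trace_op_add:
  assumes "polynomial_function A" "polynomial_function B"
  shows "trace_op (A + B) = trace_op A + trace_op B"
proof -
  have "polynomial_function (A + B)" using assms by (simp add: plus_fun_def polynomial_function_add)
  then show ?thesis
    by (simp add: fun_eq_iff vec_eq_iff trace_op_eq_divergence assms divergence_add distrib_left)
qed

theorem theorem3p4:
  fixes A :: "'n::{finite,linorder} ext_field" and k l :: nat
  assumes "A \<in> \<PP> k l"
  shows "(\<exists>!(A0, A1). A0 \<in> trace_free k l \<and> A1 \<in> trace_summand k l \<and> A = A0 + A1) \<and>
    (\<forall>A0\<in>trace_free k l. \<forall>A1\<in>trace_summand k l. A = A0 + A1 \<longrightarrow>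
      trace_op A = trace_op A1 \<and> trace_op A0 = 0 \<and>
      A1 = trace_op A \<and>\<^sub>f e_field k l \<and> A = A0 + trace_op A \<and>\<^sub>f e_field k l)"
proof -
  have A1: "A1 = trace_part k l A"
    if "A0 \<in> trace_free k l" "A1 \<in> trace_summand k l" "A = A0 + A1" for A0 A1
  proof -
    have "A0 \<in> \<PP> k l" "A1 \<in> \<PP> k l" "trace_part k l A1 = A1"
      using that(1,2) by (simp_all add: trace_summand_eq trace_image_def trace_free_iff)
    then show ?thesis
      unfolding that(3) by (simp add: trace_part_add trace_part_trace_free[OF that(1)])
  qed
  have wedge: "trace_op A \<and>\<^sub>f e_field k l = trace_part k l A"
    using trace_op_wedge_e_field[OF poly_field_polynomial[OF assms]] by (simp add: trace_part_def)
  obtain A0 A1 where ex: "A0 \<in> trace_free k l" "A1 \<in> trace_summand k l" "A = A0 + A1"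
    using invariant_complement_trace_image[of k l] assms
    unfolding trace_summand_eq invariant_complement_def by blast
  have "\<exists>!(A0, A1). A0 \<in> trace_free k l \<and> A1 \<in> trace_summand k l \<and> A = A0 + A1"
  proof (rule ex1I[of _ "(A0, A1)"])
    fix p assume "case p of (A0, A1) \<Rightarrow> A0 \<in> trace_free k l \<and> A1 \<in> trace_summand k l \<and> A = A0 + A1"
    then have p: "fst p \<in> trace_free k l" "snd p \<in> trace_summand k l" "A = fst p + snd p"
      by (auto simp: case_prod_beta)
    have "snd p = A1" using A1[OF p] A1[OF ex] by simp
    moreover from this have "fst p = A0" using p(3) ex(3) by simp
    ultimately show "p = (A0, A1)" by (simp add: prod_eq_iff)
  qed (use ex in simp)
  moreover have "trace_op A = trace_op A1 \<and> trace_op A0 = 0 \<and>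
      A1 = trace_op A \<and>\<^sub>f e_field k l \<and> A = A0 + trace_op A \<and>\<^sub>f e_field k l"
    if A0: "A0 \<in> trace_free k l" and "A1 \<in> trace_summand k l" and sum: "A = A0 + A1" for A0 A1
  proof -
    have "polynomial_function A0" "polynomial_function A1"
      using that by (auto simp: trace_free_def trace_summand_eq trace_image_def intro: poly_field_polynomial)
    moreover have "trace_op A0 = 0" using A0 by (simp add: trace_free_def)
    ultimately have "trace_op A = trace_op A1" unfolding sum by (simp add: trace_op_add)
    moreover have "A = A0 + trace_part k l A" using A1[OF that] sum by metis
    ultimately show ?thesis unfolding wedge using A1[OF that] \<open>trace_op A0 = 0\<close> by blast
  qed
  ultimately show ?thesis by blast
qed

end
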